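(* Let $\hat{A}\in\mathbb{DC}_n^{\mathrm{CM}}$ with $r=\operatorname{Rank}(\hat{A})$. Then there exist $\hat{U}\in\mathbb{DC}_n^{U}$, matrices $K_1,K_2\in\mathbb{C}^{r\times r}$ with $K_1$ invertible and $L_1,L_2\in\mathbb{C}^{r\times(n-r)}$ satisfying $$K_1K_1^*+L_1L_1^*=I_r,\qquad K_1K_2^*+K_2K_1^*+L_1L_2^*+L_2L_1^*=0,$$ and $\Sigma_1=\Sigma_{1s}+\epsilon\Sigma_{1d}=\operatorname{diag}(\mu_1,\ldots,\mu_r)$ with $\mu_1\ge\cdots\ge\mu_r$ positive appreciable dual numbers, such that $\hat A=\hat U\begin{bmatrix}\Sigma_1(K_1+\epsilon K_2)&\Sigma_1(L_1+\epsilon L_2)\\0&0\end{bmatrix}\hat U^*$ and $$\hat{A}^{\mathrm{core}}=\hat{U}\left(\begin{bmatrix}K_1^{-1}\Sigma_1^{-1}&0\\0&0\end{bmatrix}-\epsilon\begin{bmatrix}K_1^{-1}K_2K_1^{-1}\Sigma_1^{-1}&0\\0&0\end{bmatrix}\right)\hat{U}^*$$ $$=\hat{U}\left(\begin{bmatrix}K_1^{-1}\Sigma_{1s}^{-1}&0\\0&0\end{bmatrix}-\epsilon\begin{bmatrix}K_1^{-1}K_2K_1^{-1}\Sigma_{1s}^{-1}+K_1^{-1}\Sigma_{1s}^{-2}\Sigma_{1d}&0\\0&0\end{bmatrix}\right)\hat{U}^*.$$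
   Context: Dual complex numbers are $\hat a=a_s+\epsilon a_d$ with $a_s,a_d\in\mathbb{C}$, $\epsilon\ne0$, $\epsilon^2=0$, $\epsilon$ commuting with scalars; they form the ring $\mathbb{DC}$. A dual number is such an element with $a_s,a_d\in\mathbb{R}$. It is appreciable if $a_s\neq0$ and infinitesimal if $a_s=0$. Dual numbers are totally ordered by: $\hat a\le\hat b$ iff $a_s<b_s$, or $a_s=b_s$ and $a_d\le b_d$; $\hat a$ is positive if $\hat a>0$. A matrix $\hat A\in\mathbb{DC}^{m\times n}$ is written $\hat A=A_s+\epsilon A_d$ with $A_s,A_d\in\mathbb{C}^{m\times n}$; $\hat A^*=A_s^*+\epsilon A_d^*$. $\mathbb{DC}_n^U$ is the set of $\hat U\in\mathbb{DC}^{n\times n}$ with $\hat U^{-1}=\hat U^*$. $\Sigma_{1s},\Sigma_{1d}$ are the standard and infinitesimal parts of $\Sigma_1$. Dual SVD: every $\hat A\in\mathbb{DC}^{m\times n}$ can be written $\hat A=\hat P\begin{bmatrix}\Sigma_0&0\\0&0\end{bmatrix}\hat V^*$ with $\hat P\in\mathbb{DC}_m^U$, $\hat V\in\mathbb{DC}_n^U$, $\Sigma_0=\operatorname{diag}(\mu_1,\ldots,\mu_t)$ with positive dual number entries in nonincreasing order (appreciable ones first, then infinitesimal ones), where $\Sigma_0$ is uniquely determined by $\hat A$; $\operatorname{Rank}(\hat A)=t$. $\mathbb{DC}_n^{\mathrm{CM}}=\{\hat A\in\mathbb{DC}^{n\times n}:\mathcal R(\hat A^2)=\mathcal R(\hat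 A)\}$, where $\mathcal R(\hat A)=\{\hat Ax:x\in\mathbb{DC}^n\}$. For $\hat A\in\mathbb{DC}_n^{\mathrm{CM}}$ the dual core generalized inverse (DCGI) $\hat A^{\mathrm{core}}$ is the unique $\hat X$ with $\hat A\hat X\hat A=\hat A$, $\hat A\hat X^2=\hat X$, $(\hat A\hat X)^*=\hat A\hat X$. *)

theory Defs
  imports "Jordan_Normal_Form.Matrix"
begin

text \<open>
  \<open>DualNum a b\<close> stands for \<open>a + \<epsilon> b\<close> with \<open>\<epsilon>\<^sup>2 = 0\<close>. Dual complex numbers are
  \<open>complex dualnum\<close>, dual numbers are \<open>real dualnum\<close>.
\<close>

datatype 'a dualnum = DualNum (std_part: 'a) (inf_part: 'a)

instantiation dualnum :: (ring) ring
begin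

definition "0 = DualNum 0 0"
definition "x + y = DualNum (std_part x + std_part y) (inf_part x + inf_part y)"
definition "x - y = DualNum (std_part x - std_part y) (inf_part x - inf_part y)"
definition "- x = DualNum (- std_part x) (- inf_part x)"
definition "x * y = DualNum (std_part x * std_part y)
  (std_part x * inf_part y + inf_part x * std_part y)"

instance
  by standard
    (auto simp: zero_dualnum_def plus_dualnum_def minus_dualnum_def uminus_dualnum_def
      times_dualnum_def algebra_simps)

end

instance dualnum :: (comm_ring) comm_ring
  by standard (auto simp: times_dualnum_def plus_dualnum_def algebra_simps)

instantiation dualnum :: (comm_ring_1) comm_ring_1
begin

definition "1 = DualNum 1 0"

instance
  by standard (auto simp: zero_dualnum_def one_dualnum_def times_dualnum_def)

end

instantiation dualnum :: (conjugatable_ring) conjugatable_ring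
begin

definition "conjugate x = DualNum (conjugate (std_part x)) (conjugate (inf_part x))"

instance
  by standard
    (auto simp: conjugate_dualnum_def zero_dualnum_def plus_dualnum_def uminus_dualnum_def
      times_dualnum_def conjugate_dist_mul conjugate_dist_add conjugate_neg dualnum.expand
      intro: dualnum.expand)

end

instantiation dualnum :: (linorder) linorder
begin

definition "x \<le> y \<longleftrightarrow>
  std_part x < std_part y \<or> (std_part x = std_part y \<and> inf_part x \<le> inf_part y)"
definition "x < y \<longleftrightarrow>
  std_part x < std_part y \<or> (std_part x = std_part y \<and> inf_part x < inf_part (y :: 'a dualnum))"

instance
  by standard (auto simp: less_eq_dualnum_def less_dualnum_def intro: dualnum.expand)

end

definition eps :: "'a::comm_ring_1 dualnum" where
  "eps = DualNum 0 1"

definition of_std :: "'a::comm_ring_1 \<Rightarrow> 'a dualnum" where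
  "of_std a = DualNum a 0"

lemma eps_squared: "eps * eps = 0"
  by (simp add: eps_def times_dualnum_def zero_dualnum_def)

lemma dualnum_decomp: "x = of_std (std_part x) + eps * of_std (inf_part x)"
  by (cases x) (simp add: eps_def of_std_def times_dualnum_def plus_dualnum_def)

definition appreciable :: "'a::zero dualnum \<Rightarrow> bool" where
  "appreciable x \<longleftrightarrow> std_part x \<noteq> 0"

abbreviation dc_of_dual :: "real dualnum \<Rightarrow> complex dualnum" where
  "dc_of_dual \<equiv> map_dualnum complex_of_real"

abbreviation of_std_mat :: "'a::comm_ring_1 mat \<Rightarrow> 'a dualnum mat" where
  "of_std_mat \<equiv> map_mat of_std"

text \<open>The library's \<open>mat_adjoint\<close> is restricted to fields, and \<open>mat_inverse\<close> likewise.\<close>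

definition adj :: "'a::conjugatable_ring mat \<Rightarrow> 'a mat" where
  "adj A = map_mat conjugate (transpose_mat A)"

definition mat_inv :: "'a::comm_ring_1 mat \<Rightarrow> 'a mat" where
  "mat_inv A = (THE B. B \<in> carrier_mat (dim_row A) (dim_row A) \<and>
     inverts_mat A B \<and> inverts_mat B A)"

definition DC_U :: "nat \<Rightarrow> complex dualnum mat set" where
  "DC_U n = {U \<in> carrier_mat n n. inverts_mat U (adj U) \<and> inverts_mat (adj U) U}"

definition range_mat :: "'a::comm_ring_1 mat \<Rightarrow> 'a vec set" where
  "range_mat A = {A *\<^sub>v x | x. x \<in> carrier_vec (dim_col A)}"

definition DC_CM :: "nat \<Rightarrow> complex dualnum mat set" where
  "DC_CM n = {A \<in> carrier_mat n n. range_mat (A ^\<^sub>m 2) = range_mat A}"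

text \<open>
  \<open>dual_svd A P V t \<mu>\<close>: \<open>A = P diag(\<Sigma>\<^sub>0, 0) V\<^sup>*\<close> with \<open>\<Sigma>\<^sub>0 = diag(\<mu> 0, \<dots>, \<mu> (t - 1))\<close>. In the
  order on dual numbers a positive appreciable number exceeds every infinitesimal one, so
  monotonicity already places the appreciable entries first.
\<close>

definition dual_svd ::
  "complex dualnum mat \<Rightarrow> complex dualnum mat \<Rightarrow> complex dualnum mat \<Rightarrow> nat \<Rightarrow>
    (nat \<Rightarrow> real dualnum) \<Rightarrow> bool" where
  "dual_svd A P V t \<mu> \<longleftrightarrow>
     (let m = dim_row A; n = dim_col A in
       P \<in> DC_U m \<and> V \<in> DC_U n \<and> t \<le> m \<and> t \<le> n \<and>
       (\<forall>i<t. 0 < \<mu> i) \<and> (\<forall>i j. i \<le> j \<longrightarrow> j < t \<longrightarrow> \<mu> j \<le> \<mu> i) \<and>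
       A = P * four_block_mat (mat_diag t (\<lambda>i. dc_of_dual (\<mu> i))) (0\<^sub>m t (n - t))
                              (0\<^sub>m (m - t) t) (0\<^sub>m (m - t) (n - t)) * adj V)"

definition dual_rank :: "complex dualnum mat \<Rightarrow> nat" where
  "dual_rank A = (THE t. \<exists>P V \<mu>. dual_svd A P V t \<mu>)"

definition dc_core :: "complex dualnum mat \<Rightarrow> complex dualnum mat" where
  "dc_core A = (THE X. X \<in> carrier_mat (dim_row A) (dim_row A) \<and>
     A * X * A = A \<and> A * X ^\<^sub>m 2 = X \<and> adj (A * X) = A * X)"

end

(*
  Let A = A^2 Z. A classical singular value decomposition of the standard part turns A into
  D + eps F with D diagonal and nonnegative; A = A^2 Z forces F to vanish on the kernel block of D.
  Conjugating with 1 + eps S and 1 + eps T, where S and T are skew-Hermitian, replaces F by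
  F + S D - D T, which can be made a Hermitian matrix commuting with D. Diagonalizing both
  simultaneously (by the spectral theorem for the normal matrix D + iE) gives a dual singular value
  decomposition A = P Sigma V^* whose nonzero singular values are all appreciable. Their number is
  the trace of AX for every X with AXA = A, so it does not depend on the decomposition.
  With U = P, the top blocks of V^* P are K1 + eps K2 and L1 + eps L2.
*)
theory Submission
  imports Defs "Jordan_Normal_Form.Spectral_Radius" "HOL-Combinatorics.Permutations"
begin

section \<open>Adjoints and unitary matrices\<close>

text \<open>The dual complex numbers have zero divisors, so eigenvectors, kernels and one-sided
  inverses are handled over the complex numbers, and dual equations are split into standard and
  infinitesimal parts. The kernel block shapes the proof: \<open>S * D - D * T\<close> is zero there
  for all \<open>S\<close> and \<open>T\<close>, so an entry of \<open>F\<close> in that block could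
  not be removed and would survive as an infinitesimal singular value. It vanishes for this reason:
  in the bases \<open>P\<close> and \<open>V\<close> the equation for \<open>Z\<close> reads B = B W
  B Y with W = V^* P. Its standard part shows that \<open>D * Y\<close> has zero columns at the zero
  singular values; its infinitesimal part then writes \<open>F\<close> as a sum of one term with
  zero rows and one with zero columns at these positions. Rank and core inverse are definite
  descriptions, so each needs uniqueness besides a witness. The trace argument requires an inner
  inverse, and the core inverse provides it. Hence the construction runs with the length
  \<open>t\<close> of some decomposition, which is identified with the rank only at the end.\<close>

lemma adj_carrier [simp]: "A \<in> carrier_mat m n \<Longrightarrow> adj A \<in> carrier_mat n m"
  by (simp add: adj_def)

lemma dim_adj [simp]: "dim_row (adj A) = dim_col A" "dim_col (adj A) = dim_row A"
  by (simp_all add: adj_def)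

lemma index_adj [simp]:
  "i < dim_col A \<Longrightarrow> j < dim_row A \<Longrightarrow> adj A $$ (i, j) = conjugate (A $$ (j, i))"
  by (simp add: adj_def)

lemma adj_adj [simp]: "adj (adj A) = A"
  by (rule eq_matI) auto

text \<open>Conjugation is a multiplicative involution, so \<open>conjugate 1\<close> acts as a
  neutral element.\<close>

lemma conjugate_one [simp]: "conjugate (1 :: 'a :: {conjugatable_ring, comm_ring_1}) = 1"
  using conjugate_dist_mul[of "conjugate (1 :: 'a)" 1] by simp

lemma index_mat_mult:
  "i < dim_row A \<Longrightarrow> j < dim_col B \<Longrightarrow> dim_col A = dim_row B \<Longrightarrow>
    (A * B) $$ (i, j) = (\<Sum>k<dim_row B. A $$ (i, k) * B $$ (k, j))"
  by (auto simp: scalar_prod_def atLeast0LessThan intro!: sum.cong)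

lemma adj_mult:
  fixes A :: "'a :: {conjugatable_ring, comm_ring_1} mat"
  assumes "A \<in> carrier_mat m k" "B \<in> carrier_mat k n"
  shows "adj (A * B) = adj B * adj A"
  using assms
  by (intro eq_matI)
     (auto simp: index_mat_mult sum_conjugate conjugate_dist_mul mult.commute simp del: index_mult_mat(1))

lemma adj_one [simp]: "adj (1\<^sub>m n :: 'a :: {conjugatable_ring, comm_ring_1} mat) = 1\<^sub>m n"
  by (rule eq_matI) auto

lemma adj_zero [simp]: "adj (0\<^sub>m m n) = 0\<^sub>m n m"
  by (rule eq_matI) auto

lemma dim_mat_diag [simp]: "dim_row (mat_diag n f) = n" "dim_col (mat_diag n f) = n"
  by (simp_all add: mat_diag_def)

lemma adj_mat_diag: "adj (mat_diag n f) = mat_diag n (\<lambda>i. conjugate (f i))"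
  by (rule eq_matI) (auto simp: mat_diag_def)

lemma adj_four_block:
  assumes "A \<in> carrier_mat r1 c1" "B \<in> carrier_mat r1 c2"
    "C \<in> carrier_mat r2 c1" "D \<in> carrier_mat r2 c2"
  shows "adj (four_block_mat A B C D) = four_block_mat (adj A) (adj C) (adj B) (adj D)"
  using assms by (intro eq_matI) auto

text \<open>The common block sizes are premises because a composed matrix does not reveal where it
  was cut.\<close>

lemma four_block_mat_inj:
  assumes "four_block_mat A B C D = four_block_mat A' B' C' D'"
    and "A \<in> carrier_mat r1 c1" "B \<in> carrier_mat r1 c2" "C \<in> carrier_mat r2 c1" "D \<in> carrier_mat r2 c2"
    and "A' \<in> carrier_mat r1 c1" "B' \<in> carrier_mat r1 c2" "C' \<in> carrier_mat r2 c1" "D' \<in> carrier_mat r2 c2"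
  shows "A = A'" "B = B'" "C = C'" "D = D'"
proof -
  have e: "four_block_mat A B C D $$ (i, j) = four_block_mat A' B' C' D' $$ (i, j)" for i j
    using assms(1) by simp
  show "A = A'"
  proof (rule eq_matI)
    fix i j assume "i < dim_row A'" "j < dim_col A'"
    then show "A $$ (i, j) = A' $$ (i, j)" using e[of i j] assms(2-) by auto
  qed (use assms(2-) in auto)
  show "B = B'"
  proof (rule eq_matI)
    fix i j assume "i < dim_row B'" "j < dim_col B'"
    then show "B $$ (i, j) = B' $$ (i, j)" using e[of i "c1 + j"] assms(2-) by auto
  qed (use assms(2-) in auto)
  show "C = C'"
  proof (rule eq_matI)
    fix i j assume "i < dim_row C'" "j < dim_col C'"
    then show "C $$ (i, j) = C' $$ (i, j)" using e[of "r1 + i" j] assms(2-) by auto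
  qed (use assms(2-) in auto)
  show "D = D'"
  proof (rule eq_matI)
    fix i j assume "i < dim_row D'" "j < dim_col D'"
    then show "D $$ (i, j) = D' $$ (i, j)" using e[of "r1 + i" "c1 + j"] assms(2-) by auto
  qed (use assms(2-) in auto)
qed

text \<open>Stated over any commutative ring with conjugation, so that complex and dual complex
  matrices share one calculus.\<close>

definition unitary :: "nat \<Rightarrow> 'a :: {conjugatable_ring, comm_ring_1} mat \<Rightarrow> bool" where
  "unitary n U \<longleftrightarrow> U \<in> carrier_mat n n \<and> U * adj U = 1\<^sub>m n \<and> adj U * U = 1\<^sub>m n"

lemma DC_U_iff_unitary: "U \<in> DC_U n \<longleftrightarrow> unitary n U"
  by (auto simp: DC_U_def unitary_def inverts_mat_def)

lemma unitary_carrier: "unitary n U \<Longrightarrow> U \<in> carrier_mat n n"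
  by (simp add: unitary_def)

lemma unitary_adj: "unitary n U \<Longrightarrow> unitary n (adj U)"
  by (auto simp: unitary_def)

lemma unitary_one: "unitary n (1\<^sub>m n)"
  by (simp add: unitary_def)

text \<open>Shaped for products associated to the right, the normal form used throughout. A pair at
  the very end of a product has no right neighbour and is cancelled separately, by unfolding
  \<open>unitary_def\<close>.\<close>

lemma unitary_cancel:
  assumes "unitary n U" "X \<in> carrier_mat n k"
  shows "U * (adj U * X) = X" "adj U * (U * X) = X"
proof -
  have c: "U \<in> carrier_mat n n" "adj U \<in> carrier_mat n n"
    using assms(1) by (auto simp: unitary_def)
  show "U * (adj U * X) = X" "adj U * (U * X) = X"
    using assms assoc_mult_mat[OF c assms(2)] assoc_mult_mat[OF c(2) c(1) assms(2)]
    by (auto simp: unitary_def)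
qed

lemma unitary_mult:
  assumes U: "unitary n U" and V: "unitary n V"
  shows "unitary n (U * V)"
proof -
  note c = unitary_carrier[OF U] unitary_carrier[OF V]
  note a = assoc_mult_mat[of _ n n _ n _ n] mult_carrier_mat[of _ n n _ n] adj_mult[of _ n n _ n]
  have "U * adj U = 1\<^sub>m n" "adj V * V = 1\<^sub>m n" using U V by (auto simp: unitary_def)
  with c U V show ?thesis
    unfolding unitary_def[of n "U * V"] by (simp add: a unitary_cancel[of n _ _ n])
qed

lemma unitary_conj_eq:
  assumes P: "unitary n P" and V: "unitary n V" and A: "A \<in> carrier_mat n n"
  shows "A = P * (adj P * A * V) * adj V"
proof -
  note c = unitary_carrier[OF P] unitary_carrier[OF V] A
  have "V * adj V = 1\<^sub>m n" using V by (simp add: unitary_def)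
  with c P show ?thesis
    by (simp add: assoc_mult_mat[of _ n n _ n _ n] mult_carrier_mat[of _ n n _ n] unitary_cancel[of n _ _ n])
qed

text \<open>Over a field, a one-sided inverse of a square matrix is two-sided.\<close>

lemma unitary_complexI:
  fixes U :: "complex mat"
  assumes "U \<in> carrier_mat n n" "adj U * U = 1\<^sub>m n"
  shows "unitary n U"
  using assms mat_mult_left_right_inverse[of "adj U" n U] by (auto simp: unitary_def)

section \<open>Orthonormal families of complex vectors\<close>

lemma normalize_vec:
  fixes v :: "complex vec"
  assumes "v \<in> carrier_vec n" "v \<noteq> 0\<^sub>v n"
  obtains c where "c > 0"
    "(\<Sum>k<n. cnj (v $ k / of_real (sqrt c)) * (v $ k / of_real (sqrt c))) = 1"
proof -
  define c where "c = (\<Sum>k<n. (cmod (v $ k))\<^sup>2)"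
  from assms obtain k where k: "k < n" "v $ k \<noteq> 0"
    by (metis eq_vecI carrier_vecD index_zero_vec)
  then have "0 < (cmod (v $ k))\<^sup>2" by simp
  also have "\<dots> \<le> c" unfolding c_def using k by (intro member_le_sum) auto
  finally have c: "c > 0" .
  have "cnj (v $ k / of_real (sqrt c)) * (v $ k / of_real (sqrt c))
      = of_real ((cmod (v $ k))\<^sup>2) / of_real c" for k
    using c complex_norm_square[of "v $ k"] by (simp add: mult.commute flip: of_real_mult)
  then have "(\<Sum>k<n. cnj (v $ k / of_real (sqrt c)) * (v $ k / of_real (sqrt c)))
      = of_real c / of_real c"
    by (simp only: c_def of_real_sum sum_divide_distrib)
  with c show ?thesis by (intro that) auto
qed

text \<open>The set \<open>I\<close> need not be an initial segment: the singular value
  decomposition prescribes the columns with nonzero singular value, wherever they stand. The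
  induction is on the number of free positions.\<close>

lemma orthonormal_extend:
  fixes u :: "nat \<Rightarrow> nat \<Rightarrow> complex"
  assumes "I \<subseteq> {..<n}"
    and "\<And>i j. i \<in> I \<Longrightarrow> j \<in> I \<Longrightarrow> (\<Sum>k<n. cnj (u i k) * u j k) = (if i = j then 1 else 0)"
  shows "\<exists>U. unitary n U \<and> (\<forall>i\<in>I. \<forall>k<n. U $$ (k, i) = u i k)"
  using assms
proof (induction "card ({..<n} - I)" arbitrary: I u)
  case 0
  then have I: "I = {..<n}" by auto
  define U where "U = mat n n (\<lambda>(k, i). u i k)"
  have "adj U * U = 1\<^sub>m n"
    using 0(3) unfolding I
    by (intro eq_matI) (auto simp: U_def index_mat_mult simp del: index_mult_mat(1))
  then have "unitary n U" by (intro unitary_complexI) (auto simp: U_def)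
  then show ?case unfolding I by (intro exI[of _ U]) (auto simp: U_def)
next
  case (Suc x)
  then obtain m where m: "m < n" "m \<notin> I"
    by (metis Diff_iff card.empty ex_in_conv lessThan_iff nat.distinct(1))
  \<comment> \<open>The rows in \<open>I\<close> are the conjugated vectors and the others are zero,
    so the kernel of \<open>M\<close> is the orthogonal complement of the family. The zero row
    \<open>m\<close> makes \<open>M\<close> singular.\<close>
  define M where "M = mat n n (\<lambda>(i, k). if i \<in> I then cnj (u i k) else 0)"
  have M: "M \<in> carrier_mat n n" by (simp add: M_def)
  have "transpose_mat M *\<^sub>v unit_vec n m = 0\<^sub>v n"
    using m by (intro eq_vecI) (auto simp: M_def)
  moreover have "unit_vec n m \<noteq> (0\<^sub>v n :: complex vec)"
    using m by (metis index_unit_vec(2) index_zero_vec(1) zero_neq_one)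
  ultimately have "det (transpose_mat M) = 0"
    unfolding det_0_iff_vec_prod_zero_field[OF transpose_carrier_mat[THEN iffD2, OF M]]
    by (intro exI[of _ "unit_vec n m"]) simp
  then have "det M = 0" using det_transpose[OF M] by simp
  then obtain v where v: "v \<in> carrier_vec n" "v \<noteq> 0\<^sub>v n" "M *\<^sub>v v = 0\<^sub>v n"
    using det_0_iff_vec_prod_zero_field[OF M] by auto
  obtain c where c: "c > 0"
    "(\<Sum>k<n. cnj (v $ k / of_real (sqrt c)) * (v $ k / of_real (sqrt c))) = 1"
    using normalize_vec[OF v(1,2)] by blast
  have orth: "(\<Sum>k<n. cnj (u i k) * v $ k) = 0" if "i \<in> I" for i
  proof -
    have "i < n" using that Suc(3) by auto
    then have "(M *\<^sub>v v) $ i = 0" using v by simp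
    then show ?thesis using \<open>i < n\<close> that v(1)
      by (auto simp: M_def scalar_prod_def atLeast0LessThan)
  qed
  define w where "w k = v $ k / of_real (sqrt c)" for k
  define u' where "u' = u(m := w)"
  have ww: "(\<Sum>k<n. cnj (w k) * w k) = 1"
    using c(2) by (simp add: w_def)
  have uw: "(\<Sum>k<n. cnj (u i k) * w k) = 0" if "i \<in> I" for i
    using orth[OF that] by (simp add: w_def flip: sum_divide_distrib)
  have wu: "(\<Sum>k<n. cnj (w k) * u i k) = 0" if "i \<in> I" for i
  proof -
    have "(\<Sum>k<n. cnj (w k) * u i k) = cnj (\<Sum>k<n. cnj (u i k) * w k)"
      by (simp add: mult.commute)
    then show ?thesis using uw[OF that] by simp
  qed
  have "\<exists>U. unitary n U \<and> (\<forall>i\<in>insert m I. \<forall>k<n. U $$ (k, i) = u' i k)"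
  proof (rule Suc(1))
    have "{..<n} - I = insert m ({..<n} - insert m I)" using m by auto
    with Suc(2) show "x = card ({..<n} - insert m I)"
      by (metis Diff_iff card_insert_disjoint finite_Diff finite_lessThan insertI1 nat.inject)
    show "insert m I \<subseteq> {..<n}" using m Suc(3) by auto
    show "(\<Sum>k<n. cnj (u' i k) * u' j k) = (if i = j then 1 else 0)"
      if "i \<in> insert m I" "j \<in> insert m I" for i j
      using that m Suc(4) ww uw wu by (auto simp: u'_def)
  qed
  then show ?case using m unfolding u'_def by (metis fun_upd_other insertCI)
qed

section \<open>Spectral theorem and singular values over the complex numbers\<close>

lemma unit_eigenvector_exists:
  fixes A :: "complex mat"
  assumes A: "A \<in> carrier_mat n n" and n: "n > 0"
  obtains a u where "\<And>i. i < n \<Longrightarrow> (\<Sum>k<n. A $$ (i, k) * u k) = a * u i"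
    "(\<Sum>k<n. cnj (u k) * u k) = 1"
proof -
  from spectrum_non_empty[OF A n] obtain a v where "eigenvector A v a"
    by (auto simp: spectrum_def eigenvalue_def)
  then have v: "v \<in> carrier_vec n" "v \<noteq> 0\<^sub>v n" "A *\<^sub>v v = a \<cdot>\<^sub>v v"
    using A by (auto simp: eigenvector_def)
  obtain c where c: "c > 0" "(\<Sum>k<n. cnj (v $ k / of_real (sqrt c)) * (v $ k / of_real (sqrt c))) = 1"
    using normalize_vec[OF v(1,2)] by blast
  have "(\<Sum>k<n. A $$ (i, k) * (v $ k / of_real (sqrt c))) = a * (v $ i / of_real (sqrt c))"
    if i: "i < n" for i
  proof -
    have "(A *\<^sub>v v) $ i = a * v $ i" using i v by simp
    then have "(\<Sum>k<n. A $$ (i, k) * v $ k) = a * v $ i"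
      using i A v(1) by (simp add: scalar_prod_def atLeast0LessThan)
    then show ?thesis by (simp flip: sum_divide_distrib)
  qed
  with c(2) show ?thesis by (intro that[of "\<lambda>k. v $ k / of_real (sqrt c)" a]) auto
qed

lemma sum_lessThan_first: "(\<Sum>k<Suc n. f k) = f 0 + (\<Sum>k<n. f (Suc k) :: 'a :: comm_monoid_add)"
  by (rule sum.lessThan_Suc_shift)

text \<open>Normality equates the squared norms of the first row and the first column. The corner
  entry occurs in both, so the remaining row entries have squared norms with sum 0.\<close>

lemma normal_first_row:
  fixes B :: "complex mat"
  assumes B: "B \<in> carrier_mat (Suc n) (Suc n)" and nrm: "B * adj B = adj B * B"
    and col: "\<And>i. 0 < i \<Longrightarrow> i < Suc n \<Longrightarrow> B $$ (i, 0) = 0"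
    and j: "0 < j" "j < Suc n"
  shows "B $$ (0, j) = 0"
proof -
  have "(B * adj B) $$ (0, 0) = (adj B * B) $$ (0, 0)" using nrm by simp
  then have "(\<Sum>k<Suc n. B $$ (0, k) * cnj (B $$ (0, k))) = (\<Sum>k<Suc n. cnj (B $$ (k, 0)) * B $$ (k, 0))"
    using B by (simp add: index_mat_mult del: index_mult_mat(1) sum.lessThan_Suc)
  also have "\<dots> = cnj (B $$ (0, 0)) * B $$ (0, 0)"
    unfolding sum_lessThan_first using col by simp
  finally have "(\<Sum>k<n. B $$ (0, Suc k) * cnj (B $$ (0, Suc k))) = 0"
    unfolding sum_lessThan_first by (simp add: mult.commute)
  then have "(\<Sum>k<n. of_real ((cmod (B $$ (0, Suc k)))\<^sup>2) :: complex) = 0"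
    by (simp only: complex_norm_square)
  then have "(\<Sum>k<n. (cmod (B $$ (0, Suc k)))\<^sup>2) = 0"
    by (metis of_real_eq_0_iff of_real_sum)
  then have "\<forall>k<n. B $$ (0, Suc k) = 0"
    by (subst (asm) sum_nonneg_eq_0_iff) auto
  with j show ?thesis by (cases j) auto
qed

text \<open>Deflation: with a unit eigenvector as first column of \<open>Q\<close>, the first column
  of \<open>B\<close> is zero below the corner. Normality then clears the first row, and the
  remaining block \<open>C\<close> is again normal.\<close>

theorem normal_unitary_diagonalizable:
  fixes A :: "complex mat"
  assumes "A \<in> carrier_mat n n" "A * adj A = adj A * A"
  shows "\<exists>U d. unitary n U \<and> A = U * mat_diag n d * adj U"
  using assms
proof (induction n arbitrary: A)
  case 0
  then have "A = 1\<^sub>m 0 * mat_diag 0 (\<lambda>_. 0) * adj (1\<^sub>m 0)" by (intro eq_matI) auto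
  then show ?case using unitary_one by blast
next
  case (Suc n)
  let ?m = "Suc n"
  obtain a u where u: "\<And>i. i < ?m \<Longrightarrow> (\<Sum>k<?m. A $$ (i, k) * u k) = a * u i"
    "(\<Sum>k<?m. cnj (u k) * u k) = 1"
    using unit_eigenvector_exists[OF Suc(2) zero_less_Suc] by blast
  obtain Q where Q: "unitary ?m Q" "\<And>k. k < ?m \<Longrightarrow> Q $$ (k, 0) = u k"
    using orthonormal_extend[of "{0}" ?m "\<lambda>_. u"] u(2) by auto
  note Qc = unitary_carrier[OF Q(1)]
  note sq = assoc_mult_mat[of _ ?m ?m _ ?m _ ?m] mult_carrier_mat[of _ ?m ?m _ ?m]
    adj_mult[of _ ?m ?m _ ?m] unitary_cancel[of ?m _ _ ?m]
  define B where "B = adj Q * A * Q"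
  have B: "B \<in> carrier_mat ?m ?m" using Qc Suc(2) by (simp add: B_def sq)
  have A_eq: "A = Q * B * adj Q"
    unfolding B_def by (rule unitary_conj_eq[OF Q(1) Q(1) Suc(2)])
  have "B * adj B = adj Q * (A * adj A) * Q" "adj B * B = adj Q * (adj A * A) * Q"
    using Qc Suc(2) Q(1) by (simp_all add: B_def sq)
  then have nrm: "B * adj B = adj B * B" using Suc(3) by simp
  have col: "B $$ (i, 0) = (if i = 0 then a else 0)" if i: "i < ?m" for i
  proof -
    have "A * Q \<in> carrier_mat ?m ?m" using Qc Suc(2) by simp
    moreover have "(A * Q) $$ (k, 0) = a * Q $$ (k, 0)" if "k < ?m" for k
      using that Qc Suc(2) u(1)[OF that] Q(2)
      by (simp add: index_mat_mult del: index_mult_mat(1) sum.lessThan_Suc)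
    ultimately have "(adj Q * (A * Q)) $$ (i, 0) = (\<Sum>k<?m. adj Q $$ (i, k) * (a * Q $$ (k, 0)))"
      using Qc i Suc(2) by (simp add: index_mat_mult[of _ "adj Q"] del: index_mult_mat(1) sum.lessThan_Suc)
    also have "\<dots> = a * (\<Sum>k<?m. adj Q $$ (i, k) * Q $$ (k, 0))"
      by (simp add: sum_distrib_left mult_ac del: sum.lessThan_Suc)
    also have "(\<Sum>k<?m. adj Q $$ (i, k) * Q $$ (k, 0)) = (adj Q * Q) $$ (i, 0)"
      using Qc i by (simp add: index_mat_mult del: index_mult_mat(1) sum.lessThan_Suc)
    also have "adj Q * Q = 1\<^sub>m ?m" using Q(1) by (simp add: unitary_def)
    finally show ?thesis using Qc Suc(2) i by (simp add: B_def sq)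
  qed
  have row: "B $$ (0, j) = (if j = 0 then a else 0)" if "j < ?m" for j
    using normal_first_row[OF B nrm] col that by auto
  define C where "C = mat n n (\<lambda>(i, j). B $$ (Suc i, Suc j))"
  have C: "C \<in> carrier_mat n n" by (simp add: C_def)
  define D0 where "D0 = mat_diag 1 (\<lambda>_. a)"
  have D0: "D0 \<in> carrier_mat 1 1" by (simp add: D0_def)
  let ?Z = "0\<^sub>m 1 n" and ?Z' = "0\<^sub>m n 1"
  have B_blk: "B = four_block_mat D0 ?Z ?Z' C"
    using B C D0 col row by (intro eq_matI) (auto simp: C_def D0_def mat_diag_def)
  have adjB: "adj B = four_block_mat (adj D0) ?Z ?Z' (adj C)"
    unfolding B_blk using adj_four_block[OF D0 zero_carrier_mat zero_carrier_mat C] by simp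
  have "adj D0 * D0 \<in> carrier_mat 1 1" "adj C * C \<in> carrier_mat n n"
    using D0 C mult_carrier_mat[OF adj_carrier[OF D0] D0] mult_carrier_mat[OF adj_carrier[OF C] C] by auto
  then have "four_block_mat (D0 * adj D0) ?Z ?Z' (C * adj C) = four_block_mat (adj D0 * D0) ?Z ?Z' (adj C * C)"
    using nrm unfolding adjB
    unfolding B_blk
    using C D0 by (simp add: mult_four_block_mat[of _ 1 1 _ n _ n _ _ 1 _ n])
  then have CC: "C * adj C = adj C * C"
    by (rule four_block_mat_inj(4)[where ?r1.0 = 1 and ?c1.0 = 1 and ?r2.0 = n and ?c2.0 = n])
      (use C D0 mult_carrier_mat[OF adj_carrier[OF D0] D0] mult_carrier_mat[OF adj_carrier[OF C] C]
        mult_carrier_mat[OF C adj_carrier[OF C]] mult_carrier_mat[OF D0 adj_carrier[OF D0]] in auto)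
  from Suc(1)[OF C CC] obtain W d where W: "unitary n W" and C_eq: "C = W * mat_diag n d * adj W"
    by auto
  note Wc = unitary_carrier[OF W]
  define V where "V = four_block_mat (1\<^sub>m 1) ?Z ?Z' W"
  define e where "e i = (case i of 0 \<Rightarrow> a | Suc i \<Rightarrow> d i)" for i
  have V: "V \<in> carrier_mat ?m ?m"
    using four_block_carrier_mat[OF one_carrier_mat[of 1] Wc] by (simp add: V_def)
  have adjV: "adj V = four_block_mat (1\<^sub>m 1) ?Z ?Z' (adj W)"
    unfolding V_def using adj_four_block[OF one_carrier_mat zero_carrier_mat zero_carrier_mat Wc]
    by simp
  have e: "mat_diag ?m e = four_block_mat D0 ?Z ?Z' (mat_diag n d)"
    by (intro eq_matI) (auto simp: mat_diag_def D0_def e_def split: nat.splits)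
  have one: "1\<^sub>m (Suc n) = four_block_mat (1\<^sub>m 1) ?Z ?Z' (1\<^sub>m n)"
    using four_block_one_mat[of 1 n] by simp
  have "unitary ?m V"
  proof (rule unitary_complexI[OF V])
    show "adj V * V = 1\<^sub>m ?m" unfolding adjV unfolding V_def one using W Wc
      by (simp add: mult_four_block_mat[of _ 1 1 _ n _ n _ _ 1 _ n] unitary_def)
  qed
  moreover have "B = V * mat_diag ?m e * adj V"
    unfolding adjV unfolding B_blk e C_eq V_def
    using Wc D0 left_mult_zero_mat[OF mat_diag_dim[of n d]]
      right_mult_zero_mat[OF mult_carrier_mat[OF Wc mat_diag_dim[of n d]]]
      mult_carrier_mat[OF mult_carrier_mat[OF Wc mat_diag_dim[of n d]] adj_carrier[OF Wc]]
    by (simp add: mult_four_block_mat[of _ 1 1 _ n _ n _ _ 1 _ n])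
  ultimately have "A = (Q * V) * mat_diag ?m e * adj (Q * V)"
    using A_eq V Qc by (simp add: sq)
  then show ?case using unitary_mult[OF Q(1) \<open>unitary ?m V\<close>] by blast
qed

text \<open>Commutation makes \<open>N\<close> normal. \<open>A\<close> and \<open>B\<close> are
  recovered from \<open>N\<close> and \<open>adj N\<close>, so one unitary matrix serves both, and
  the diagonal entries are the real and imaginary parts of the eigenvalues of
  \<open>N\<close>.\<close>

theorem commuting_hermitian_diagonalizable:
  fixes A B :: "complex mat"
  assumes A: "A \<in> carrier_mat n n" "adj A = A" and B: "B \<in> carrier_mat n n" "adj B = B"
    and AB: "A * B = B * A"
  obtains U d e where "unitary n U"
    "A = U * mat_diag n (\<lambda>i. complex_of_real (d i)) * adj U"
    "B = U * mat_diag n (\<lambda>i. complex_of_real (e i)) * adj U"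
proof -
  define N where "N = A + \<i> \<cdot>\<^sub>m B"
  have N: "N \<in> carrier_mat n n" using A B by (simp add: N_def)
  have adj_entry: "cnj (A $$ (j, i)) = A $$ (i, j)" "cnj (B $$ (j, i)) = B $$ (i, j)" if "i < n" "j < n" for i j
    using A B that by (metis index_adj carrier_matD conjugate_complex_def)+
  have adjN: "adj N = A - \<i> \<cdot>\<^sub>m B"
    using A(1) B(1) adj_entry by (intro eq_matI) (auto simp: N_def)
  have "N * adj N = adj N * N"
    unfolding adjN unfolding N_def using A(1) B(1) AB
    by (simp add: add_mult_distrib_mat[of _ n n _ _ n] mult_add_distrib_mat[of _ n n _ n]
       minus_mult_distrib_mat[of _ n n _ _ n] mult_minus_distrib_mat[of _ n n _ n]
       mult_smult_distrib[of _ n n _ n] mult_smult_assoc_mat[of _ n n _ n])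
      (auto intro!: eq_matI simp: algebra_simps)
  from normal_unitary_diagonalizable[OF N this] obtain U c
    where U: "unitary n U" and N_eq: "N = U * mat_diag n c * adj U" by auto
  note Uc = unitary_carrier[OF U]
  note sq = assoc_mult_mat[of _ n n _ n _ n] mult_carrier_mat[of _ n n _ n] adj_mult[of _ n n _ n]
  have adjN_eq: "adj N = U * mat_diag n (\<lambda>i. cnj (c i)) * adj U"
    unfolding N_eq using Uc by (simp add: sq adj_mat_diag)
  \<comment> \<open>For fixed \<open>U\<close> the conjugated diagonal matrices form a linear
    family, so both combinations below are computed on diagonal entries.\<close>
  have lin: "x \<cdot>\<^sub>m (U * mat_diag n f * adj U) + y \<cdot>\<^sub>m (U * mat_diag n g * adj U)
      = U * mat_diag n (\<lambda>i. x * f i + y * g i) * adj U" for x y f g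
  proof -
    have "mat_diag n (\<lambda>i. x * f i + y * g i) = x \<cdot>\<^sub>m mat_diag n f + y \<cdot>\<^sub>m mat_diag n g"
      by (intro eq_matI) (auto simp: mat_diag_def)
    then show ?thesis using Uc
      by (simp add: add_mult_distrib_mat[of _ n n _ _ n] mult_add_distrib_mat[of _ n n _ n]
       mult_smult_distrib[of _ n n _ n] mult_smult_assoc_mat[of _ n n _ n])
  qed
  have "A = (1/2) \<cdot>\<^sub>m N + (1/2) \<cdot>\<^sub>m adj N"
    unfolding adjN unfolding N_def using A(1) B(1) by (intro eq_matI) (auto simp: field_simps)
  also have "\<dots> = U * mat_diag n (\<lambda>i. complex_of_real (Re (c i))) * adj U"
    unfolding adjN_eq unfolding N_eq lin
    by (intro arg_cong[of _ _ "\<lambda>f. U * mat_diag n f * adj U"]) (auto simp: complex_eq_iff)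
  finally have 1: "A = U * mat_diag n (\<lambda>i. complex_of_real (Re (c i))) * adj U" .
  \<comment> \<open>This is \<open>N - adj N\<close> divided by 2i.\<close>
  have "B = (-\<i>/2) \<cdot>\<^sub>m N + (\<i>/2) \<cdot>\<^sub>m adj N"
    unfolding adjN unfolding N_def using A(1) B(1) by (intro eq_matI) (auto simp: field_simps)
  also have "\<dots> = U * mat_diag n (\<lambda>i. complex_of_real (Im (c i))) * adj U"
    unfolding adjN_eq unfolding N_eq lin
    by (intro arg_cong[of _ _ "\<lambda>f. U * mat_diag n f * adj U"]) (auto simp: complex_eq_iff)
  finally show ?thesis by (rule that[OF U 1])
qed

text \<open>An eigenbasis \<open>V\<close> of \<open>adj A * A\<close> makes the columns of
  \<open>A * V\<close> orthogonal. Their norms are the singular values, and the nonzero columns,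
  normalized, are completed to \<open>P\<close>. Sorting is deferred to the dual singular
  values.\<close>

theorem complex_svd:
  fixes A :: "complex mat"
  assumes A: "A \<in> carrier_mat n n"
  obtains P V s where "unitary n P" "unitary n V" "\<And>i. (0 :: real) \<le> s i"
    "A = P * mat_diag n (\<lambda>i. complex_of_real (s i)) * adj V"
proof -
  note sq = assoc_mult_mat[of _ n n _ n _ n] mult_carrier_mat[of _ n n _ n] adj_mult[of _ n n _ n]
    unitary_cancel[of n _ _ n]
  obtain V d where V: "unitary n V" and AA: "adj A * A = V * mat_diag n d * adj V"
    using normal_unitary_diagonalizable[of "adj A * A" n] A by (auto simp: sq)
  note Vc = unitary_carrier[OF V]
  define C where "C = A * V"
  have C: "C \<in> carrier_mat n n" using A Vc by (simp add: C_def)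
  have "adj C * C = adj V * (adj A * A) * V" using A Vc by (simp add: C_def sq)
  also have "\<dots> = mat_diag n d" unfolding AA
    using A Vc V by (simp add: sq) (simp add: unitary_def right_mult_one_mat[of _ n n])
  finally have CC: "adj C * C = mat_diag n d" .
  have gram: "(\<Sum>k<n. cnj (C $$ (k, i)) * C $$ (k, j)) = (if i = j then d i else 0)"
    if "i < n" "j < n" for i j
  proof -
    have "(adj C * C) $$ (i, j) = (if i = j then d i else 0)"
      unfolding CC using that by (simp add: mat_diag_def)
    then show ?thesis using that C by (simp add: index_mat_mult del: index_mult_mat(1))
  qed
  define t where "t i = (\<Sum>k<n. (cmod (C $$ (k, i)))\<^sup>2)" for i
  \<comment> \<open>No bound on \<open>i\<close> is required, since squared norms of unspecified
    entries are nonnegative as well.\<close>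
  have t: "0 \<le> t i" for i by (simp add: t_def sum_nonneg)
  have d: "d i = of_real (t i)" if "i < n" for i
  proof -
    have "cnj (C $$ (k, i)) * C $$ (k, i) = of_real ((cmod (C $$ (k, i)))\<^sup>2)" for k
      using complex_norm_square[of "C $$ (k, i)"] by (simp add: mult.commute)
    then show ?thesis using gram[OF that that] by (simp add: t_def)
  qed
  define I where "I = {i. i < n \<and> t i \<noteq> 0}"
  define u where "u i k = C $$ (k, i) / of_real (sqrt (t i))" for i k
  have "\<exists>P. unitary n P \<and> (\<forall>i\<in>I. \<forall>k<n. P $$ (k, i) = u i k)"
  proof (rule orthonormal_extend)
    fix i j assume ij: "i \<in> I" "j \<in> I"
    have "(\<Sum>k<n. cnj (u i k) * u j k)
        = (\<Sum>k<n. cnj (C $$ (k, i)) * C $$ (k, j)) / (of_real (sqrt (t i)) * of_real (sqrt (t j)))"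
      by (simp add: u_def sum_divide_distrib)
    also have "\<dots> = (if i = j then 1 else 0)"
      using ij gram[of i j] d[of i] t[of i] by (auto simp: I_def simp flip: of_real_mult)
    finally show "(\<Sum>k<n. cnj (u i k) * u j k) = (if i = j then 1 else 0)" .
  qed (auto simp: I_def)
  then obtain P where P: "unitary n P" "\<And>i k. i \<in> I \<Longrightarrow> k < n \<Longrightarrow> P $$ (k, i) = u i k" by auto
  note Pc = unitary_carrier[OF P(1)]
  have "C = P * mat_diag n (\<lambda>i. complex_of_real (sqrt (t i)))"
  proof -
    have "C $$ (k, i) = P $$ (k, i) * of_real (sqrt (t i))" if "k < n" "i < n" for k i
    proof (cases "i \<in> I")
      case True
      then show ?thesis using P(2)[OF True] that by (auto simp: u_def I_def)
    next
      case False
      then have "t i = 0" using that by (simp add: I_def)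
      moreover have "C $$ (k, i) = 0"
        using \<open>t i = 0\<close> that unfolding t_def by (subst (asm) sum_nonneg_eq_0_iff) auto
      ultimately show ?thesis by simp
    qed
    then show ?thesis using C Pc by (intro eq_matI) (auto simp: mat_diag_mult_right[OF Pc])
  qed
  moreover have "A = C * adj V"
    using A Vc V by (simp add: C_def sq unitary_def right_mult_one_mat[of _ n n])
  ultimately have "A = P * mat_diag n (\<lambda>i. complex_of_real (sqrt (t i))) * adj V" by simp
  then show ?thesis using that[OF P(1) V, of "\<lambda>i. sqrt (t i)"] t by simp
qed

section \<open>Standard and infinitesimal parts of matrices\<close>

lemma dualnum_parts [simp]:
  "std_part (0 :: 'a :: ring dualnum) = 0" "inf_part (0 :: 'a dualnum) = 0"
  "std_part (1 :: 'b :: comm_ring_1 dualnum) = 1" "inf_part (1 :: 'b dualnum) = 0"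
  "std_part (eps :: 'b dualnum) = 0" "inf_part (eps :: 'b dualnum) = 1"
  "std_part (of_std c :: 'b dualnum) = c" "inf_part (of_std c :: 'b dualnum) = 0"
  "std_part (x + y :: 'a dualnum) = std_part x + std_part y"
  "inf_part (x + y :: 'a dualnum) = inf_part x + inf_part y"
  "std_part (x - y :: 'a dualnum) = std_part x - std_part y"
  "inf_part (x - y :: 'a dualnum) = inf_part x - inf_part y"
  "std_part (- x :: 'a dualnum) = - std_part x"
  "inf_part (- x :: 'a dualnum) = - inf_part x"
  "std_part (x * y :: 'a dualnum) = std_part x * std_part y"
  "inf_part (x * y :: 'a dualnum) = std_part x * inf_part y + inf_part x * std_part y"
  "std_part (conjugate z :: 'c :: conjugatable_ring dualnum) = conjugate (std_part z)"
  "inf_part (conjugate z :: 'c dualnum) = conjugate (inf_part z)"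
  by (simp_all add: zero_dualnum_def one_dualnum_def eps_def of_std_def plus_dualnum_def
      minus_dualnum_def uminus_dualnum_def times_dualnum_def conjugate_dualnum_def)

lemma dualnum_sum_parts [simp]:
  "std_part (sum f I :: 'a :: ring dualnum) = (\<Sum>i\<in>I. std_part (f i))"
  "inf_part (sum f I :: 'a dualnum) = (\<Sum>i\<in>I. inf_part (f i))"
  by (induction I rule: infinite_finite_induct) auto

lemma dualnum_eq_iff: "x = y \<longleftrightarrow> std_part x = std_part y \<and> inf_part x = inf_part y"
  by (cases x; cases y) auto

abbreviation std_mat :: "'a dualnum mat \<Rightarrow> 'a mat" where
  "std_mat \<equiv> map_mat std_part"

abbreviation inf_mat :: "'a dualnum mat \<Rightarrow> 'a mat" where
  "inf_mat \<equiv> map_mat inf_part"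

lemma dual_mat_eqI:
  assumes "A \<in> carrier_mat m n" "B \<in> carrier_mat m n" "std_mat A = std_mat B" "inf_mat A = inf_mat B"
  shows "A = B"
proof (rule eq_matI)
  fix i j assume ij: "i < dim_row B" "j < dim_col B"
  have "std_mat A $$ (i, j) = std_mat B $$ (i, j)" "inf_mat A $$ (i, j) = inf_mat B $$ (i, j)"
    using assms(3,4) by simp_all
  then show "A $$ (i, j) = B $$ (i, j)" using ij assms(1,2) by (auto simp: dualnum_eq_iff)
qed (use assms in auto)

lemma std_mat_mult:
  assumes "A \<in> carrier_mat m k" "B \<in> carrier_mat k n"
  shows "std_mat (A * B :: 'a :: ring dualnum mat) = std_mat A * std_mat B"
  using assms by (intro eq_matI) (auto simp: scalar_prod_def)

text \<open>The Leibniz rule: with eps squared equal to 0, the infinitesimal part behaves like a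
  derivative.\<close>

lemma inf_mat_mult:
  assumes "A \<in> carrier_mat m k" "B \<in> carrier_mat k n"
  shows "inf_mat (A * B :: 'a :: ring dualnum mat) = std_mat A * inf_mat B + inf_mat A * std_mat B"
  using assms by (intro eq_matI) (auto simp: scalar_prod_def sum.distrib)

lemma std_inf_mat_simps [simp]:
  "std_mat (1\<^sub>m n :: 'a :: comm_ring_1 dualnum mat) = 1\<^sub>m n"
  "inf_mat (1\<^sub>m n :: 'a :: comm_ring_1 dualnum mat) = 0\<^sub>m n n"
  "std_mat (0\<^sub>m m n :: 'a :: comm_ring_1 dualnum mat) = 0\<^sub>m m n"
  "inf_mat (0\<^sub>m m n :: 'a :: comm_ring_1 dualnum mat) = 0\<^sub>m m n"
  "std_mat (of_std_mat X :: 'a :: comm_ring_1 dualnum mat) = X"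
  "inf_mat (of_std_mat X :: 'a :: comm_ring_1 dualnum mat) = 0\<^sub>m (dim_row X) (dim_col X)"
  "std_mat (adj Y) = adj (std_mat (Y :: 'b :: conjugatable_ring dualnum mat))"
  "inf_mat (adj Y) = adj (inf_mat Y)"
  by (auto intro!: eq_matI)

abbreviation dual_mat :: "'a :: comm_ring_1 mat \<Rightarrow> 'a mat \<Rightarrow> 'a dualnum mat" where
  "dual_mat X Y \<equiv> of_std_mat X + eps \<cdot>\<^sub>m of_std_mat Y"

lemma dual_mat_parts:
  assumes "X \<in> carrier_mat m n" "Y \<in> carrier_mat m n"
  shows "std_mat (dual_mat X Y) = X" "inf_mat (dual_mat X Y) = Y"
  using assms by (auto intro!: eq_matI)

lemma dual_mat_of_parts: "dual_mat (std_mat A) (inf_mat A) = (A :: 'a :: comm_ring_1 dualnum mat)"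
  by (rule eq_matI) (auto simp: dualnum_eq_iff)

lemma of_std_mat_mult:
  assumes "X \<in> carrier_mat m k" "Y \<in> carrier_mat k n"
  shows "of_std_mat (X * Y) = of_std_mat X * of_std_mat Y"
  using assms
  by (intro dual_mat_eqI[of _ m n])
     (auto simp: std_mat_mult[of _ m k _ n] inf_mat_mult[of _ m k _ n] mult_carrier_mat[of _ m k _ n])

lemma unitary_of_std_mat:
  assumes "unitary n U"
  shows "unitary n (of_std_mat U)"
proof -
  have a: "adj (of_std_mat U) = of_std_mat (adj U)"
    by (auto intro!: eq_matI simp: dualnum_eq_iff)
  have o: "of_std_mat (1\<^sub>m n) = 1\<^sub>m n"
    by (auto intro!: eq_matI simp: dualnum_eq_iff)
  show ?thesis
    using assms o by (auto simp: unitary_def a simp flip: of_std_mat_mult[of _ n n _ n])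
qed

text \<open>Both products are 1 plus eps times \<open>S + adj S\<close>, which is zero. These
  matrices change infinitesimal parts while leaving standard parts fixed.\<close>

lemma unitary_one_plus_eps:
  assumes S: "S \<in> carrier_mat n n" "adj S = - S"
  shows "unitary n (dual_mat (1\<^sub>m n) S)"
proof -
  let ?U = "dual_mat (1\<^sub>m n) S"
  have U: "?U \<in> carrier_mat n n" "adj ?U \<in> carrier_mat n n" using S by auto
  note p = dual_mat_parts[OF one_carrier_mat S(1)]
  have "?U * adj ?U = 1\<^sub>m n"
    using S U by (intro dual_mat_eqI[of _ n n])
      (auto simp: std_mat_mult[of _ n n _ n] inf_mat_mult[of _ n n _ n] p uminus_l_inv_mat)
  moreover have "adj ?U * ?U = 1\<^sub>m n"
    using S U by (intro dual_mat_eqI[of _ n n])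
      (auto simp: std_mat_mult[of _ n n _ n] inf_mat_mult[of _ n n _ n] p comm_add_mat[of S n n])
  ultimately show ?thesis using U by (simp add: unitary_def)
qed

section \<open>Diagonal matrices and the index-one condition\<close>

lemma index_mat_diag_mult:
  assumes "A \<in> carrier_mat n m" "i < n" "j < m"
  shows "(mat_diag n f * A) $$ (i, j) = f i * A $$ (i, j)"
  using assms by (simp add: mat_diag_mult_left)

lemma index_mult_mat_diag:
  assumes "A \<in> carrier_mat m n" "i < m" "j < n"
  shows "(A * mat_diag n f) $$ (i, j) = A $$ (i, j) * f j"
  using assms by (simp add: mat_diag_mult_right)

text \<open>
  On the support of \<open>D\<close> the matrix \<open>W\<close> has a right, hence a left inverse; \<open>M\<close> below extends this
  block by the identity.
\<close>
lemma diag_index_one: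
  fixes n :: nat and W Y X :: "'a :: field mat" and s :: "nat \<Rightarrow> 'a"
  defines "D \<equiv> mat_diag n s"
  assumes W: "W \<in> carrier_mat n n" and Y: "Y \<in> carrier_mat n n" and X: "X \<in> carrier_mat n n"
    and D: "D * (W * (D * Y)) = D" and DX: "D * (W * (D * X)) = 0\<^sub>m n n"
  shows "D * X = 0\<^sub>m n n"
proof -
  \<comment> \<open>\<open>J\<close> and \<open>J'\<close> project onto the support of
    \<open>s\<close> and its complement; \<open>H\<close> inverts \<open>D\<close> on the support,
    in the sense \<open>H * D = J\<close>.\<close>
  define p where "p i = (if s i = 0 then 0 else 1 :: 'a)" for i
  define J where "J = mat_diag n p"
  define J' where "J' = mat_diag n (\<lambda>i. 1 - p i)"
  define H where "H = mat_diag n (\<lambda>i. inverse (s i))"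
  have c: "D \<in> carrier_mat n n" "J \<in> carrier_mat n n" "J' \<in> carrier_mat n n" "H \<in> carrier_mat n n"
    by (simp_all add: D_def J_def J'_def H_def)
  note sq = assoc_mult_mat[of _ n n _ n _ n] mult_carrier_mat[of _ n n _ n]
    add_mult_distrib_mat[of _ n n _ _ n] mult_add_distrib_mat[of _ n n _ n]
    left_add_zero_mat[of _ n n] right_add_zero_mat[of _ n n]
  have ps: "(\<lambda>i. p i * p i) = p" "(\<lambda>i. p i * s i) = s" "(\<lambda>i. p i * (1 - p i)) = (\<lambda>_. 0)"
     "(\<lambda>i. (1 - p i) * s i) = (\<lambda>_. 0)" "(\<lambda>i. (1 - p i) * (1 - p i)) = (\<lambda>i. 1 - p i)"
     "(\<lambda>i. inverse (s i) * s i) = p"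
    by (auto simp: p_def fun_eq_iff)
  have z: "mat_diag n (\<lambda>_. 0) = 0\<^sub>m n n" by (auto intro!: eq_matI simp: mat_diag_def)
  have dd: "J * J = J" "J * D = D" "J * J' = 0\<^sub>m n n" "J' * D = 0\<^sub>m n n" "J' * J' = J'" "H * D = J"
    by (simp_all add: J_def J'_def D_def H_def ps z)
  have dd': "J * (J * Q) = J * Q" "J * (D * Q) = D * Q" "J * (J' * Q) = 0\<^sub>m n n"
    "J' * (D * Q) = 0\<^sub>m n n" "H * (D * Q) = J * Q"
    if "Q \<in> carrier_mat n n" for Q
    using that c dd by (simp_all flip: assoc_mult_mat[of _ n n _ n _ n])
  have JJ: "J + J' = 1\<^sub>m n" by (auto intro!: eq_matI simp: J_def J'_def mat_diag_def)
  define M where "M = J * W * J + J'"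
  define R where "R = D * Y * J + J'"
  have MR: "M \<in> carrier_mat n n" "R \<in> carrier_mat n n" using c W Y by (simp_all add: M_def R_def sq)
  have JW: "J * (W * (D * Q)) = H * (D * (W * (D * Q)))" if "Q \<in> carrier_mat n n" for Q
    using that c W by (simp add: dd' sq)
  have "J * (W * (D * (Y * J))) = H * ((D * (W * (D * Y))) * J)"
    using c W Y by (simp add: JW sq)
  also have "\<dots> = J" unfolding D using c by (simp add: dd' dd)
  finally have "J * (W * (D * (Y * J))) = J" .
  \<comment> \<open>The mixed terms contain \<open>J * J'\<close> or \<open>J' * D\<close> and
    vanish.\<close>
  then have "M * R = J + J'" using c W Y
    by (simp add: M_def R_def sq dd dd')
  then have "R * M = 1\<^sub>m n" using mat_mult_left_right_inverse[OF MR] JJ by simp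
  \<comment> \<open>The invertible \<open>M\<close> kills \<open>D * X\<close>: the part on the
    support by hypothesis, the other part because \<open>J' * D\<close> is zero.\<close>
  moreover have "J * (W * (D * X)) = 0\<^sub>m n n" using JW[OF X] DX c by simp
  then have "M * (D * X) = 0\<^sub>m n n"
    using c W X by (simp add: M_def sq dd')
  then have "R * M * (D * X) = 0\<^sub>m n n"
    using MR c X by (simp add: sq)
  ultimately show ?thesis using c X by (simp add: sq)
qed

section \<open>Dual singular value decomposition\<close>

text \<open>For skew-Hermitian \<open>S\<close> and \<open>T\<close>,
  \<open>F + S * D - D * T\<close> is the infinitesimal part of the product of
  \<open>1 + eps S\<close>, \<open>D + eps F\<close> and the adjoint of \<open>1 + eps T\<close>.
  The outcome \<open>E\<close> lives on pairs with equal nonzero singular values and hence commutes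
  with \<open>D\<close>.\<close>

lemma diag_svd_first_order:
  fixes F :: "complex mat" and s :: "nat \<Rightarrow> real"
  defines "D \<equiv> \<lambda>n. mat_diag n (\<lambda>i. complex_of_real (s i))"
  assumes F: "F \<in> carrier_mat n n" and s: "\<And>i. 0 \<le> s i"
    and F0: "\<And>i j. i < n \<Longrightarrow> j < n \<Longrightarrow> s i = 0 \<Longrightarrow> s j = 0 \<Longrightarrow> F $$ (i, j) = 0"
  obtains S T E where "S \<in> carrier_mat n n" "T \<in> carrier_mat n n" "E \<in> carrier_mat n n"
    "adj S = - S" "adj T = - T" "adj E = E" "F + S * D n - D n * T = E"
    "\<And>i j. i < n \<Longrightarrow> j < n \<Longrightarrow> s i \<noteq> s j \<or> s i = 0 \<Longrightarrow> E $$ (i, j) = 0"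
proof -
  define f where "f i j = F $$ (i, j)" for i j
  \<comment> \<open>The entries \<open>(i, j)\<close> and \<open>(j, i)\<close> of the equation form a linear system for \<open>S\<close> and \<open>T\<close> of
    determinant \<open>\<plusminus> q i j\<close>; where it is singular, only the Hermitian part of \<open>F\<close> survives. If
    \<open>s i = s j = 0\<close>, the quotient in \<open>S\<close> is 0.\<close>
  define q where "q i j = complex_of_real ((s i)\<^sup>2 - (s j)\<^sup>2)" for i j
  define S where "S = mat n n (\<lambda>(i, j). if s i = s j then - (f i j - cnj (f j i)) / (2 * s i)
    else (s j * f i j + s i * cnj (f j i)) / q i j)"
  define T where "T = mat n n (\<lambda>(i, j). if s i = s j then 0
    else (s i * f i j + s j * cnj (f j i)) / q i j)"
  define E where "E = mat n n (\<lambda>(i, j). if s i = s j then (f i j + cnj (f j i)) / 2 else 0)"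
  \<comment> \<open>Nonnegativity enters here: distinct nonnegative numbers have distinct
    squares.\<close>
  have q: "q i j \<noteq> 0" if "s i \<noteq> s j" for i j
    using that s[of i] s[of j] unfolding q_def
    by (metis eq_iff_diff_eq_0 of_real_eq_0_iff power2_eq_iff_nonneg)
  have q_swap: "q j i = - q i j" "cnj (q i j) = q i j" for i j by (simp_all add: q_def)
  have c: "S \<in> carrier_mat n n" "T \<in> carrier_mat n n" "E \<in> carrier_mat n n"
    by (simp_all add: S_def T_def E_def)
  have "adj S = - S"
  proof (rule eq_matI)
    fix i j assume "i < dim_row (- S)" "j < dim_col (- S)"
    then show "adj S $$ (i, j) = (- S) $$ (i, j)"
      using q[of i j] by (cases "s j = 0") (auto simp: S_def q_swap(2) q_swap(1)[of j i] field_simps)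
  qed (use c in auto)
  moreover have "adj T = - T"
  proof (rule eq_matI)
    fix i j assume "i < dim_row (- T)" "j < dim_col (- T)"
    then show "adj T $$ (i, j) = (- T) $$ (i, j)"
      using q[of i j] by (auto simp: T_def q_swap(2) q_swap(1)[of j i] field_simps)
  qed (use c in auto)
  moreover have "adj E = E" by (rule eq_matI) (auto simp: E_def)
  moreover have "F + S * D n - D n * T = E"
  proof (rule eq_matI)
    fix i j assume "i < dim_row E" "j < dim_col E"
    then have ij: "i < n" "j < n" using c by auto
    have "(F + S * D n - D n * T) $$ (i, j) = f i j + S $$ (i, j) * s j - s i * T $$ (i, j)"
      using ij c F unfolding D_def
      by (simp add: index_mat_diag_mult[of _ n n] index_mult_mat_diag[of _ n n] f_def del: index_mult_mat(1))
    also have "\<dots> = E $$ (i, j)"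
    proof (cases "s i = s j")
      case True
      then show ?thesis using ij F0[of i j] F0[of j i]
        by (cases "s j = 0") (auto simp: S_def T_def E_def f_def field_simps)
    next
      case False
      \<comment> \<open>The conjugate terms cancel; the other two add up to
        \<open>- q i j * f i j\<close> over \<open>q i j\<close>.\<close>
      have "f i j + (s j * f i j + s i * cnj (f j i)) / q i j * s j
          - s i * ((s i * f i j + s j * cnj (f j i)) / q i j) = 0"
        using q[OF False] by (simp add: field_simps) (simp add: q_def power2_eq_square algebra_simps)
      then show ?thesis using False ij by (simp add: S_def T_def E_def)
    qed
    finally show "(F + S * D n - D n * T) $$ (i, j) = E $$ (i, j)" .
  qed (use c F in \<open>auto simp: D_def\<close>)
  moreover have "E $$ (i, j) = 0" if "i < n" "j < n" "s i \<noteq> s j \<or> s i = 0" for i j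
    using that F0[of i j] F0[of j i] by (auto simp: E_def f_def)
  ultimately show ?thesis using that c by blast
qed

text \<open>\<open>E\<close> annihilates the kernel of \<open>D\<close>, so a common eigenvector
  with \<open>d i = 0\<close> has \<open>e i = 0\<close> too. This excludes singular values that are
  nonzero but infinitesimal.\<close>

lemma diag_commuting_spectrum:
  fixes E :: "complex mat" and s :: "nat \<Rightarrow> real"
  defines "D \<equiv> \<lambda>n. mat_diag n (\<lambda>i. complex_of_real (s i))"
  assumes E: "E \<in> carrier_mat n n" "adj E = E" and s: "\<And>i. 0 \<le> s i"
    and E0: "\<And>i j. i < n \<Longrightarrow> j < n \<Longrightarrow> s i \<noteq> s j \<or> s i = 0 \<Longrightarrow> E $$ (i, j) = 0"
  obtains W d e where "unitary n W"
    "D n = W * mat_diag n (\<lambda>i. complex_of_real (d i)) * adj W"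
    "E = W * mat_diag n (\<lambda>i. complex_of_real (e i)) * adj W"
    "\<And>i. i < n \<Longrightarrow> 0 < d i \<or> d i = 0 \<and> e i = 0"
proof -
  have D: "D n \<in> carrier_mat n n" "adj (D n) = D n" by (simp_all add: D_def adj_mat_diag)
  have DE: "D n * E = E * D n"
  proof (rule eq_matI)
    fix i j assume "i < dim_row (E * D n)" "j < dim_col (E * D n)"
    then have "i < n" "j < n" using E D by auto
    then show "(D n * E) $$ (i, j) = (E * D n) $$ (i, j)"
      using E E0[of i j]
      by (cases "s i = s j")
        (auto simp: D_def index_mat_diag_mult[of _ n n] index_mult_mat_diag[of _ n n] simp del: index_mult_mat(1))
  qed (use E D in auto)
  from commuting_hermitian_diagonalizable[OF D E DE] obtain W d e where W: "unitary n W"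
    and D_eq: "D n = W * mat_diag n (\<lambda>i. complex_of_real (d i)) * adj W"
    and E_eq: "E = W * mat_diag n (\<lambda>i. complex_of_real (e i)) * adj W" by blast
  note Wc = unitary_carrier[OF W]
  note sq = assoc_mult_mat[of _ n n _ n _ n] mult_carrier_mat[of _ n n _ n] unitary_cancel[of n _ _ n]
  have WW: "adj W * W = 1\<^sub>m n" using W by (simp add: unitary_def)
  have "adj W * (D n * W) = mat_diag n (\<lambda>i. complex_of_real (d i))"
    unfolding D_eq using W Wc by (simp add: sq WW right_mult_one_mat[of _ n n])
  moreover have "adj W * (E * W) = mat_diag n (\<lambda>i. complex_of_real (e i))"
    unfolding E_eq using W Wc by (simp add: sq WW right_mult_one_mat[of _ n n])
  ultimately have diags: "(adj W * (D n * W)) $$ (i, i) = d i" "(adj W * (E * W)) $$ (i, i) = e i"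
    if "i < n" for i using that by (simp_all add: mat_diag_def)
  have "0 < d i \<or> d i = 0 \<and> e i = 0" if i: "i < n" for i
  proof -
    have "(D n * W) $$ (k, i) = s k * W $$ (k, i)" if "k < n" for k
      unfolding D_def using that i Wc by (simp add: index_mat_diag_mult[of _ n n] del: index_mult_mat(1))
    then have "complex_of_real (d i) = (\<Sum>k<n. cnj (W $$ (k, i)) * (s k * W $$ (k, i)))"
      using diags(1)[OF i] i Wc D
      by (simp add: index_mat_mult[of _ "adj W"] del: index_mult_mat(1))
    also have "\<dots> = complex_of_real (\<Sum>k<n. s k * (cmod (W $$ (k, i)))\<^sup>2)"
      using complex_norm_square by (simp add: mult_ac)
    \<comment> \<open>The eigenvalue is the Rayleigh quotient of column \<open>i\<close> of
      \<open>W\<close>. If it is 0, that column is supported on the zeros of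
      \<open>s\<close>.\<close>
    finally have d: "d i = (\<Sum>k<n. s k * (cmod (W $$ (k, i)))\<^sup>2)"
      by (simp only: of_real_eq_iff)
    have nonneg: "0 \<le> s k * (cmod (W $$ (k, i)))\<^sup>2" for k using s by simp
    show ?thesis
    proof (cases "d i = 0")
      case False
      then show ?thesis using d nonneg by (simp add: less_le sum_nonneg)
    next
      case True
      then have z: "s k = 0 \<or> W $$ (k, i) = 0" if "k < n" for k
        using that nonneg unfolding d by (subst (asm) sum_nonneg_eq_0_iff) auto
      have "(E * W) $$ (j, i) = 0" if j: "j < n" for j
      proof -
        have "E $$ (j, k) * W $$ (k, i) = 0" if "k < n" for k
          using z[OF that] E0[OF j that] by (cases "s j = s k") auto
        then have "(\<Sum>k<n. E $$ (j, k) * W $$ (k, i)) = 0" by (intro sum.neutral) auto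
        then show ?thesis using i j E Wc by (simp add: index_mat_mult del: index_mult_mat(1))
      qed
      then have "complex_of_real (e i) = 0"
        using diags(2)[OF i] i E Wc
        by (simp add: index_mat_mult[of _ "adj W"] del: index_mult_mat(1))
      with True show ?thesis by simp
    qed
  qed
  then show ?thesis using that W D_eq E_eq by blast
qed

theorem regular_dual_svd:
  fixes A :: "complex dualnum mat"
  assumes A: "A \<in> carrier_mat n n" and Z: "Z \<in> carrier_mat n n" and AZ: "A * (A * Z) = A"
  obtains P V \<mu> where "unitary n P" "unitary n V"
    "A = P * mat_diag n (\<lambda>i. dc_of_dual (\<mu> i)) * adj V"
    "\<And>i. i < n \<Longrightarrow> 0 < std_part (\<mu> i) \<or> \<mu> i = 0"
proof -
  note sq = assoc_mult_mat[of _ n n _ n _ n] mult_carrier_mat[of _ n n _ n] adj_mult[of _ n n _ n]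
    unitary_cancel[of n _ _ n]
  note parts = std_mat_mult[of _ n n _ n] inf_mat_mult[of _ n n _ n]
  have "std_mat A \<in> carrier_mat n n" using A by simp
  then obtain P V s where P: "unitary n P" and V: "unitary n V" and s: "\<And>i. (0 :: real) \<le> s i"
    and As: "std_mat A = P * mat_diag n (\<lambda>i. complex_of_real (s i)) * adj V"
    using complex_svd by blast
  define D where "D = mat_diag n (\<lambda>i. complex_of_real (s i))"
  define P' where "P' = of_std_mat P"
  define V' where "V' = of_std_mat V"
  note PV' = unitary_of_std_mat[OF P, folded P'_def] unitary_of_std_mat[OF V, folded V'_def]
  note c = A Z unitary_carrier[OF P] unitary_carrier[OF V] unitary_carrier[OF PV'(1)] unitary_carrier[OF PV'(2)]
  have D: "D \<in> carrier_mat n n" by (simp add: D_def)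
  define B where "B = adj P' * A * V'"
  have B: "B \<in> carrier_mat n n" using c by (simp add: B_def sq)
  have A_eq: "A = P' * B * adj V'"
    unfolding B_def by (rule unitary_conj_eq[OF PV' A])
  define F where "F = inf_mat B"
  have F: "F \<in> carrier_mat n n" using B by (simp add: F_def)
  have "adj P * (std_mat A * V) = D"
    unfolding As D_def using c P V by (simp add: sq) (simp add: unitary_def right_mult_one_mat[of _ n n])
  then have Bs: "std_mat B = D"
    using c by (simp add: B_def parts sq) (simp add: P'_def V'_def)
  have B_eq: "B = dual_mat D F"
    using dual_mat_of_parts[of B] Bs by (simp add: F_def)
  \<comment> \<open>\<open>W\<close> links the two bases: \<open>A * A\<close> becomes
    \<open>B * W * B\<close> between \<open>P'\<close> and \<open>adj V'\<close>, so the hypothesis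
    on \<open>Z\<close> turns into an equation for \<open>B\<close> alone.\<close>
  define W where "W = adj V' * P'"
  define Y where "Y = adj V' * Z * V'"
  have WY: "W \<in> carrier_mat n n" "Y \<in> carrier_mat n n" using c by (simp_all add: W_def Y_def sq)
  have "B * (W * (B * Y)) = adj P' * (A * (A * Z)) * V'"
    using c PV' by (simp add: B_def W_def Y_def sq)
  then have BWBY: "B * (W * (B * Y)) = B" using AZ by (simp add: B_def)
  define Ws where "Ws = std_mat W"
  define Ys where "Ys = std_mat Y"
  have Wi: "inf_mat W = 0\<^sub>m n n" using c
    by (simp add: W_def parts) (simp add: P'_def V'_def)
  have WYs: "Ws \<in> carrier_mat n n" "Ys \<in> carrier_mat n n" using WY by (simp_all add: Ws_def Ys_def)
  have DWDY: "D * (Ws * (D * Ys)) = D"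
  proof -
    have "std_mat (B * (W * (B * Y))) = std_mat B" by (simp only: BWBY)
    then show ?thesis using B WY by (simp add: parts sq Bs Ws_def Ys_def)
  qed
  \<comment> \<open>Infinitesimal part of the same equation; \<open>W\<close> contributes none
    because \<open>P'\<close> and \<open>V'\<close> are purely standard.\<close>
  have F_eq: "D * (Ws * (D * inf_mat Y + F * Ys)) + F * (Ws * (D * Ys)) = F"
  proof -
    have "inf_mat (B * (W * (B * Y))) = inf_mat B" by (simp only: BWBY)
    then show ?thesis using B WY D F WYs
      by (simp add: parts sq Bs Wi left_mult_zero_mat[of _ n n] right_add_zero_mat[of _ n n]
          mult_carrier_mat[of _ n n _ n] flip: Ws_def Ys_def F_def)
  qed
  \<comment> \<open>Projection onto the kernel coordinates of \<open>D\<close>. It extracts the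
    columns of \<open>D * Ys\<close> at zero singular values, which \<open>diag_index_one\<close>
    shows to vanish.\<close>
  define N where "N = mat_diag n (\<lambda>i. if s i = 0 then 1 else 0 :: complex)"
  have N: "N \<in> carrier_mat n n" by (simp add: N_def)
  have DN: "D * N = 0\<^sub>m n n"
    unfolding D_def N_def mat_diag_diag by (auto simp: mat_diag_def intro!: eq_matI)
  have "D * (Ws * (D * (Ys * N))) = D * (Ws * (D * Ys)) * N"
    using D WYs N by (simp add: sq)
  then have "D * (Ws * (D * (Ys * N))) = 0\<^sub>m n n" using DWDY DN by simp
  then have DYN: "D * (Ys * N) = 0\<^sub>m n n"
    using diag_index_one[of Ws n Ys "Ys * N"] DWDY WYs N unfolding D_def by (simp add: sq)
  \<comment> \<open>In \<open>F_eq\<close>, the summand starting with \<open>D\<close> has zero row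
    \<open>i\<close> and the one ending with \<open>D * Ys\<close> has zero column
    \<open>j\<close>.\<close>
  have F0: "F $$ (i, j) = 0" if ij: "i < n" "j < n" and sij: "s i = 0" "s j = 0" for i j
  proof -
    have DYj: "(D * Ys) $$ (k, j) = 0" if "k < n" for k
    proof -
      have "(D * Ys * N) $$ (k, j) = (D * Ys) $$ (k, j)"
        using that ij sij D WYs unfolding N_def
        by (subst index_mult_mat_diag[of _ n n]) (simp_all add: mult_carrier_mat[of _ n n _ n])
      moreover have "(D * Ys * N) $$ (k, j) = 0"
        using DYN that ij D WYs N by (simp add: sq)
      ultimately show ?thesis by simp
    qed
    have c1: "D * inf_mat Y + F * Ys \<in> carrier_mat n n" using D F WY WYs by (simp add: sq)
    have "(D * (Ws * (D * inf_mat Y + F * Ys))) $$ (i, j) = 0"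
      unfolding D_def using ij sij WYs c1[unfolded D_def]
      by (subst index_mat_diag_mult[of _ n n]) (simp_all add: sq)
    moreover have "(F * Ws * (D * Ys)) $$ (i, j) = 0"
      using ij DYj F WYs D
      by (subst index_mat_mult) (simp_all add: sq del: index_mult_mat(1) assoc_mult_mat)
    then have "(F * (Ws * (D * Ys))) $$ (i, j) = 0" using F WYs D by (simp add: sq)
    moreover have "F $$ (i, j) = (D * (Ws * (D * inf_mat Y + F * Ys)) + F * (Ws * (D * Ys))) $$ (i, j)"
      by (simp only: F_eq)
    ultimately show ?thesis using ij F WYs D c1 by (simp add: sq del: index_mult_mat(1))
  qed
  obtain S T E where ST: "S \<in> carrier_mat n n" "T \<in> carrier_mat n n" and E: "E \<in> carrier_mat n n"
    and adjST: "adj S = - S" "adj T = - T" and adjE: "adj E = E" and FE: "F + S * D - D * T = E"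
    and E0: "\<And>i j. i < n \<Longrightarrow> j < n \<Longrightarrow> s i \<noteq> s j \<or> s i = 0 \<Longrightarrow> E $$ (i, j) = 0"
    using diag_svd_first_order[where s = s, OF F s F0, folded D_def] by blast
  obtain R d e where R: "unitary n R"
    and D_eq: "D = R * mat_diag n (\<lambda>i. complex_of_real (d i)) * adj R"
    and E_eq: "E = R * mat_diag n (\<lambda>i. complex_of_real (e i)) * adj R"
    and de: "\<And>i. i < n \<Longrightarrow> 0 < d i \<or> d i = 0 \<and> e i = 0"
    using diag_commuting_spectrum[where s = s, OF E adjE s E0, folded D_def] by blast
  define X where "X = dual_mat (1\<^sub>m n) S"
  define X' where "X' = dual_mat (1\<^sub>m n) T"
  define R' where "R' = of_std_mat R"
  define \<mu> where "\<mu> i = DualNum (d i) (e i)" for i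
  define G where "G = mat_diag n (\<lambda>i. dc_of_dual (\<mu> i))"
  have X: "unitary n X" "unitary n X'"
    using unitary_one_plus_eps ST adjST by (simp_all add: X_def X'_def)
  have R': "unitary n R'" using unitary_of_std_mat[OF R] by (simp add: R'_def)
  note c' = unitary_carrier[OF X(1)] unitary_carrier[OF X(2)] unitary_carrier[OF R'] unitary_carrier[OF R]
  have G: "G \<in> carrier_mat n n" by (simp add: G_def)
  have Gs: "std_mat G = mat_diag n (\<lambda>i. complex_of_real (d i))"
    "inf_mat G = mat_diag n (\<lambda>i. complex_of_real (e i))"
    by (auto simp: G_def mat_diag_def \<mu>_def intro!: eq_matI)
  \<comment> \<open>\<open>X\<close> and \<open>X'\<close> have standard part 1, so \<open>D\<close>
    is kept; the minus sign before \<open>D * T\<close> comes from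
    \<open>adj T = - T\<close>.\<close>
  have "X * (B * adj X') = dual_mat D E"
  proof (rule dual_mat_eqI[of _ n n])
    have Xp: "std_mat X = 1\<^sub>m n" "inf_mat X = S" "std_mat X' = 1\<^sub>m n" "inf_mat X' = T"
      using dual_mat_parts[of "1\<^sub>m n" n n] ST by (simp_all add: X_def X'_def)
    note Ep = dual_mat_parts[OF D E]
    show "std_mat (X * (B * adj X')) = std_mat (dual_mat D E)"
      unfolding Ep using c' B D by (simp add: parts sq Xp Bs)
    have "inf_mat (X * (B * adj X')) = D * (- T) + F + S * D"
      using c' B D ST F
      by (simp add: parts sq Xp Bs adjST left_mult_one_mat[of _ n n] right_mult_one_mat[of _ n n]
          flip: F_def)
    also have "\<dots> = F + S * D - D * T"
      using D ST F by (intro eq_matI) auto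
    finally show "inf_mat (X * (B * adj X')) = inf_mat (dual_mat D E)"
      unfolding Ep FE .
  qed (use c' B D E in \<open>auto simp: sq\<close>)
  also have "\<dots> = R' * (G * adj R')"
  proof (rule dual_mat_eqI[of _ n n])
    have Rp: "std_mat R' = R" "inf_mat R' = 0\<^sub>m n n" using c' by (simp_all add: R'_def)
    note Ep = dual_mat_parts[OF D E]
    show "std_mat (dual_mat D E) = std_mat (R' * (G * adj R'))"
      unfolding Ep using c' G by (simp add: parts sq Rp Gs D_eq)
    show "inf_mat (dual_mat D E) = inf_mat (R' * (G * adj R'))"
      unfolding Ep using c' G
      by (simp add: parts sq Rp Gs E_eq left_mult_zero_mat[of _ n n] right_mult_zero_mat[of _ n n]
          left_add_zero_mat[of _ n n] right_add_zero_mat[of _ n n])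
  qed (use c' B D E G in \<open>auto simp: sq\<close>)
  finally have XBX: "X * (B * adj X') = R' * (G * adj R')" .
  have "B = adj X * (X * (B * adj X')) * X'"
    using c' B X by (simp add: sq) (simp add: unitary_def right_mult_one_mat[of _ n n])
  then have B': "B = adj X * (R' * (G * adj R')) * X'" by (simp only: XBX)
  let ?P = "P' * adj X * R'" and ?V = "V' * adj X' * R'"
  have "unitary n ?P" "unitary n ?V"
    using PV' X R' by (auto intro!: unitary_mult unitary_adj)
  moreover have "A = ?P * G * adj ?V"
    unfolding A_eq B' using c c' G by (simp add: sq)
  moreover have "0 < std_part (\<mu> i) \<or> \<mu> i = 0" if "i < n" for i
    using de[OF that] by (auto simp: \<mu>_def zero_dualnum_def)
  ultimately show ?thesis using that unfolding G_def by blast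
qed

section \<open>Ordering the singular values and cutting off the zeros\<close>

lemma exists_sorting_permutation:
  fixes f :: "nat \<Rightarrow> 'a :: linorder"
  obtains p where "p permutes {..<n}" "\<And>i j. i \<le> j \<Longrightarrow> j < n \<Longrightarrow> f (p j) \<le> f (p i)"
proof -
  define xs where "xs = map f [0..<n]"
  have "mset (rev (sort xs)) = mset xs" by simp
  from mset_eq_permutation[OF this] obtain p
    where p: "p permutes {..<length xs}" "permute_list p xs = rev (sort xs)" by blast
  have len: "length xs = n" by (simp add: xs_def)
  have nth: "rev (sort xs) ! i = f (p i)" if "i < n" for i
  proof -
    have "rev (sort xs) ! i = xs ! p i"
      using that len permute_list_nth[OF p(1), of i] p(2) by simp
    then show ?thesis using that len permutes_in_image[OF p(1), of i] by (simp add: xs_def)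
  qed
  have "f (p j) \<le> f (p i)" if "i \<le> j" "j < n" for i j
    using that sorted_rev_nth_mono[of "rev (sort xs)" i j] len nth by simp
  with p(1) len show ?thesis by (intro that) auto
qed

text \<open>Each entry of the product is a sum over the common column index of \<open>U\<close> and
  \<open>V\<close>, and \<open>p\<close> merely reorders that sum.\<close>

lemma unitary_permute_cols:
  fixes U V :: "'a :: {conjugatable_ring, comm_ring_1} mat"
  assumes U: "unitary n U" and p: "p permutes {..<n}" and V: "V \<in> carrier_mat n n"
  shows "unitary n (mat n n (\<lambda>(i, j). U $$ (i, p j)))"
    and "U * mat_diag n f * adj V =
      mat n n (\<lambda>(i, j). U $$ (i, p j)) * mat_diag n (f \<circ> p) * adj (mat n n (\<lambda>(i, j). V $$ (i, p j)))"
proof -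
  let ?perm = "\<lambda>U. mat n n (\<lambda>(i, j). U $$ (i, p j))"
  have pn: "p i < n" if "i < n" for i using permutes_in_image[OF p, of i] that by simp
  have pi: "p i = p j \<longleftrightarrow> i = j" for i j using permutes_inj[OF p] by (auto dest: injD)
  have reindex: "(\<Sum>k<n. g (p k)) = sum g {..<n}" for g :: "nat \<Rightarrow> 'a"
    using sum.permute[OF p, of g] by (simp add: o_def)
  have Uc: "U \<in> carrier_mat n n" by (rule unitary_carrier[OF U])
  have P: "?perm X * mat_diag n (g \<circ> p) * adj (?perm Y) = X * mat_diag n g * adj Y"
    if X: "X \<in> carrier_mat n n" and Y: "Y \<in> carrier_mat n n" for X Y :: "'a mat" and g
  proof (rule eq_matI)
    fix i j assume "i < dim_row (X * mat_diag n g * adj Y)" "j < dim_col (X * mat_diag n g * adj Y)"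
    then have ij: "i < n" "j < n" using X Y by auto
    have "(?perm X * mat_diag n (g \<circ> p) * adj (?perm Y)) $$ (i, j)
        = (\<Sum>k<n. X $$ (i, p k) * g (p k) * conjugate (Y $$ (j, p k)))"
      using ij X Y by (subst index_mat_mult) (simp_all add: index_mult_mat_diag[of _ n n] del: index_mult_mat(1))
    also have "\<dots> = (\<Sum>k<n. X $$ (i, k) * g k * conjugate (Y $$ (j, k)))"
      by (rule reindex[of "\<lambda>k. X $$ (i, k) * g k * conjugate (Y $$ (j, k))"])
    also have "\<dots> = (X * mat_diag n g * adj Y) $$ (i, j)"
      using ij X Y by (subst index_mat_mult) (simp_all add: index_mult_mat_diag[of _ n n] del: index_mult_mat(1))
    finally show "(?perm X * mat_diag n (g \<circ> p) * adj (?perm Y)) $$ (i, j)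
      = (X * mat_diag n g * adj Y) $$ (i, j)" .
  qed (use X Y in auto)
  show "U * mat_diag n f * adj V = ?perm U * mat_diag n (f \<circ> p) * adj (?perm V)"
    using P[OF Uc V] by simp
  \<comment> \<open>The reordering with constant diagonal 1 and \<open>U\<close> on both
    sides.\<close>
  have "?perm U * adj (?perm U) = 1\<^sub>m n"
    using P[OF Uc Uc, of "\<lambda>_. 1"] U Uc
    by (simp add: o_def unitary_def right_mult_one_mat[of _ n n])
  moreover have "adj (?perm U) * ?perm U = 1\<^sub>m n"
  proof (rule eq_matI)
    fix i j assume "i < dim_row (1\<^sub>m n :: 'a mat)" "j < dim_col (1\<^sub>m n :: 'a mat)"
    then have ij: "i < n" "j < n" by auto
    have "(adj (?perm U) * ?perm U) $$ (i, j) = (adj U * U) $$ (p i, p j)"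
      using ij pn Uc by (simp add: index_mat_mult del: index_mult_mat(1))
    also have "\<dots> = 1\<^sub>m n $$ (i, j)" using U ij pn pi by (simp add: unitary_def)
    finally show "(adj (?perm U) * ?perm U) $$ (i, j) = 1\<^sub>m n $$ (i, j)" .
  qed auto
  ultimately show "unitary n (?perm U)" by (simp add: unitary_def)
qed

text \<open>Column \<open>j\<close> of \<open>A\<close> is \<open>A\<close> applied to a unit
  vector, hence in the range of the square; the preimages are the columns of \<open>Z\<close>. The
  range condition thus becomes a matrix equation that can be split into parts.\<close>

lemma range_mat_square:
  fixes A :: "'a :: comm_ring_1 mat"
  assumes A: "A \<in> carrier_mat n n" and R: "range_mat (A ^\<^sub>m 2) = range_mat A"
  obtains Z where "Z \<in> carrier_mat n n" "A * (A * Z) = A"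
proof -
  have A2: "A ^\<^sub>m 2 = A * A" using A by (simp add: numeral_2_eq_2)
  have "\<exists>z. z \<in> carrier_vec n \<and> (A * A) *\<^sub>v z = col A j" if j: "j < n" for j
  proof -
    have "A *\<^sub>v unit_vec n j = col A j"
      using A j by (intro eq_vecI) auto
    then have "col A j \<in> range_mat A"
      using A unfolding range_mat_def mem_Collect_eq by (intro exI[of _ "unit_vec n j"]) simp
    then have "col A j \<in> range_mat (A * A)" using R A2 by simp
    then show ?thesis using A unfolding range_mat_def by auto
  qed
  then obtain z where z: "\<And>j. j < n \<Longrightarrow> z j \<in> carrier_vec n \<and> (A * A) *\<^sub>v z j = col A j"
    by metis
  define Z where "Z = mat n n (\<lambda>(i, j). z j $ i)"
  have Z: "Z \<in> carrier_mat n n" by (simp add: Z_def)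
  define B where "B = A * A"
  have B: "B \<in> carrier_mat n n" using A by (simp add: B_def)
  have "B * Z = A"
  proof (rule eq_matI)
    fix i j assume "i < dim_row A" "j < dim_col A"
    then have ij: "i < n" "j < n" using A by auto
    have "col Z j = z j" using ij z[OF ij(2)] by (intro eq_vecI) (auto simp: Z_def)
    then have "(B * Z) $$ (i, j) = (B *\<^sub>v z j) $ i"
      using ij B Z by simp
    then show "(B * Z) $$ (i, j) = A $$ (i, j)" using z[OF ij(2), folded B_def] ij A by simp
  qed (use A B Z in auto)
  then show ?thesis using that[OF Z] A Z by (simp add: B_def assoc_mult_mat[of _ n n _ n _ n])
qed

theorem CM_dual_svd:
  assumes "A \<in> DC_CM n"
  obtains P V r \<mu> where "dual_svd A P V r \<mu>" "\<And>i. i < r \<Longrightarrow> appreciable (\<mu> i)"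
proof -
  have A: "A \<in> carrier_mat n n" and R: "range_mat (A ^\<^sub>m 2) = range_mat A"
    using assms by (auto simp: DC_CM_def)
  obtain Z where Z: "Z \<in> carrier_mat n n" "A * (A * Z) = A"
    using range_mat_square[OF A R] .
  obtain P V \<nu> where P: "unitary n P" and V: "unitary n V"
    and A_eq: "A = P * mat_diag n (\<lambda>i. dc_of_dual (\<nu> i)) * adj V"
    and \<nu>: "\<And>i. i < n \<Longrightarrow> 0 < std_part (\<nu> i) \<or> \<nu> i = 0"
    using regular_dual_svd[OF A Z] by blast
  obtain p where p: "p permutes {..<n}" "\<And>i j. i \<le> j \<Longrightarrow> j < n \<Longrightarrow> \<nu> (p j) \<le> \<nu> (p i)"
    using exists_sorting_permutation[of n \<nu>] by blast
  have pn: "p i < n" if "i < n" for i using permutes_in_image[OF p(1), of i] that by simp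
  define \<mu> where "\<mu> = \<nu> \<circ> p"
  define P' where "P' = mat n n (\<lambda>(i, j). P $$ (i, p j))"
  define V' where "V' = mat n n (\<lambda>(i, j). V $$ (i, p j))"
  have PV': "unitary n P'" "unitary n V'"
    using unitary_permute_cols(1)[OF _ p(1) unitary_carrier[OF V]] P V by (auto simp: P'_def V'_def)
  have A_eq': "A = P' * mat_diag n (\<lambda>i. dc_of_dual (\<mu> i)) * adj V'"
    using unitary_permute_cols(2)[OF P p(1) unitary_carrier[OF V], of "\<lambda>i. dc_of_dual (\<nu> i)"] A_eq
    by (simp add: P'_def V'_def \<mu>_def o_def)
  have \<mu>: "0 < std_part (\<mu> i) \<or> \<mu> i = 0" if "i < n" for i
    using \<nu>[OF pn[OF that]] by (simp add: \<mu>_def)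
  have \<mu>_mono: "\<mu> j \<le> \<mu> i" if "i \<le> j" "j < n" for i j using p(2)[OF that] by (simp add: \<mu>_def)
  \<comment> \<open>The number of nonzero entries, as zeros come last in the sorted list; the
    disjunct \<open>k = n\<close> covers the case without zeros.\<close>
  define r where "r = (LEAST k. k = n \<or> \<mu> k = 0)"
  have r_le: "r \<le> n" unfolding r_def by (rule Least_le) simp
  have r_end: "r = n \<or> \<mu> r = 0" unfolding r_def by (rule LeastI[of _ n]) simp
  have below: "0 < std_part (\<mu> i)" if "i < r" for i
    using not_less_Least[of i, folded r_def] that r_le \<mu>[of i] unfolding r_def by fastforce
  \<comment> \<open>After a zero an entry is at most 0, which excludes a positive standard
    part.\<close>
  have above: "\<mu> i = 0" if "r \<le> i" "i < n" for i
    using \<mu>_mono[of r i] that r_end \<mu>[of i] by (auto simp: less_eq_dualnum_def)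
  have "mat_diag n (\<lambda>i. dc_of_dual (\<mu> i)) = four_block_mat (mat_diag r (\<lambda>i. dc_of_dual (\<mu> i)))
      (0\<^sub>m r (n - r)) (0\<^sub>m (n - r) r) (0\<^sub>m (n - r) (n - r))"
    using r_le above by (intro eq_matI) (auto simp: mat_diag_def zero_dualnum_def)
  moreover have dims: "dim_row A = n" "dim_col A = n" using A by auto
  ultimately have "dual_svd A P' V' r \<mu>"
    using PV' r_le A_eq' below \<mu>_mono
    unfolding dual_svd_def Let_def dims DC_U_iff_unitary by (auto simp: less_dualnum_def)
  moreover have "appreciable (\<mu> i)" if "i < r" for i using below[OF that] by (simp add: appreciable_def)
  ultimately show ?thesis using that by blast
qed

section \<open>The rank as a trace\<close>

lemma trace_mult_comm:
  fixes A B :: "'a :: comm_ring_1 mat"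
  assumes "A \<in> carrier_mat n n" "B \<in> carrier_mat n n"
  shows "(\<Sum>i<n. (A * B) $$ (i, i)) = (\<Sum>i<n. (B * A) $$ (i, i))"
  using assms sum.swap[of "\<lambda>i k. A $$ (i, k) * B $$ (k, i)" "{..<n}" "{..<n}"]
  by (simp add: index_mat_mult mult.commute del: index_mult_mat(1))

text \<open>In the bases of the decomposition, the diagonal of \<open>D * Y\<close> consists of
  \<open>t\<close> ones followed by zeros. The decomposition is arbitrary: it is the inner inverse
  that excludes infinitesimal singular values.\<close>

lemma dual_svd_regular_trace:
  assumes svd: "dual_svd A P V t \<mu>" and A: "A \<in> carrier_mat n n" and X: "X \<in> carrier_mat n n"
    and AXA: "A * X * A = A"
  shows "(\<Sum>i<n. (A * X) $$ (i, i)) = of_nat t"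
proof -
  define D where "D = mat_diag n (\<lambda>i. if i < t then dc_of_dual (\<mu> i) else 0)"
  have D: "D \<in> carrier_mat n n" by (simp add: D_def)
  have P: "unitary n P" and V: "unitary n V" and t: "t \<le> n" and pos: "\<And>i. i < t \<Longrightarrow> 0 < \<mu> i"
    using svd A by (auto simp: dual_svd_def DC_U_iff_unitary)
  have "four_block_mat (mat_diag t (\<lambda>i. dc_of_dual (\<mu> i))) (0\<^sub>m t (n - t)) (0\<^sub>m (n - t) t)
      (0\<^sub>m (n - t) (n - t)) = D"
    using t by (intro eq_matI) (auto simp: D_def mat_diag_def)
  then have A_eq: "A = P * D * adj V" using svd A by (simp add: dual_svd_def Let_def)
  note sq = assoc_mult_mat[of _ n n _ n _ n] mult_carrier_mat[of _ n n _ n] unitary_cancel[of n _ _ n]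
  note c = unitary_carrier[OF P] unitary_carrier[OF V]
  define Y where "Y = adj V * X * P"
  have Y: "Y \<in> carrier_mat n n" using c X by (simp add: Y_def sq)
  have "adj P * (A * X * A) * V = D * Y * (D * (adj V * V))"
    using c P V D X unfolding A_eq by (simp add: Y_def sq)
  moreover have "adj P * A * V = D * (adj V * V)"
    using c P V D unfolding A_eq by (simp add: sq)
  moreover have "D * (adj V * V) = D" using V D by (simp add: unitary_def right_mult_one_mat[of _ n n])
  ultimately have DYD: "D * Y * D = D" using AXA by simp
  have diag: "(D * Y) $$ (i, i) = (if i < t then 1 else 0)" if i: "i < n" for i
  proof (cases "i < t")
    case True
    define m where "m = dc_of_dual (\<mu> i)"
    have "(D * Y * D) $$ (i, i) = m * Y $$ (i, i) * m"
      using i True D Y unfolding D_def m_def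
      by (simp add: index_mult_mat_diag[of _ n n] index_mat_diag_mult[of _ n n]
          mult_carrier_mat[of _ n n _ n] del: index_mult_mat(1) assoc_mult_mat)
    moreover have "D $$ (i, i) = m" using i True by (simp add: D_def mat_diag_def m_def)
    ultimately have eq: "m * Y $$ (i, i) * m = m" using DYD by simp
    have "m \<noteq> 0" using pos[OF True] by (cases "\<mu> i") (auto simp: m_def zero_dualnum_def less_dualnum_def)
    \<comment> \<open>If \<open>m\<close> were infinitesimal, the left side of \<open>eq\<close>
      would contain two infinitesimal factors and vanish.\<close>
    then have ms: "std_part m \<noteq> 0"
      using eq by (auto simp: dualnum_eq_iff)
    have "m * Y $$ (i, i) = 1"
    proof -
      let ?y = "Y $$ (i, i)"
      have 1: "std_part m * std_part ?y = 1" using eq ms by (auto simp: dualnum_eq_iff)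
      have "std_part (m * ?y) * inf_part m + inf_part (m * ?y) * std_part m = inf_part m"
        using eq by (auto simp: dualnum_eq_iff)
      then have "inf_part (m * ?y) = 0" using 1 ms by simp
      then show ?thesis using 1 by (simp add: dualnum_eq_iff)
    qed
    then show ?thesis using True i Y by (simp add: D_def m_def index_mat_diag_mult[of _ n n] del: index_mult_mat(1))
  next
    case False
    then show ?thesis using i Y by (simp add: D_def index_mat_diag_mult[of _ n n] del: index_mult_mat(1))
  qed
  have "(\<Sum>i<n. (A * X) $$ (i, i)) = (\<Sum>i<n. (P * (D * adj V * X)) $$ (i, i))"
    using c X D unfolding A_eq by (simp add: sq)
  also have "\<dots> = (\<Sum>i<n. (D * adj V * X * P) $$ (i, i))"
    using c X D by (intro trace_mult_comm) (simp_all add: sq)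
  also have "D * adj V * X * P = D * Y" using c X D by (simp add: Y_def sq)
  also have "(\<Sum>i<n. (D * Y) $$ (i, i)) = (\<Sum>i<n. if i < t then 1 else 0)" using diag by simp
  also have "\<dots> = (\<Sum>i\<in>{..<n} \<inter> {..<t}. 1)"
    by (simp only: sum.inter_restrict finite_lessThan lessThan_iff)
  also have "{..<n} \<inter> {..<t} = {..<t}" using t by auto
  finally show ?thesis by simp
qed

lemma dual_rank_eqI:
  assumes svd: "dual_svd A P V t \<mu>" and A: "A \<in> carrier_mat n n" and X: "X \<in> carrier_mat n n"
    and AXA: "A * X * A = A"
  shows "dual_rank A = t"
  unfolding dual_rank_def
proof (rule the_equality)
  show "\<exists>P V \<mu>. dual_svd A P V t \<mu>" using svd by blast
  fix t' assume "\<exists>P V \<mu>. dual_svd A P V t' \<mu>"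
  then have "(of_nat t' :: complex dualnum) = of_nat t"
    using dual_svd_regular_trace[OF _ A X AXA] svd by metis
  \<comment> \<open>Natural numbers stay distinct in the dual complex numbers because their standard
    parts do.\<close>
  moreover have "std_part (of_nat k :: complex dualnum) = of_nat k" for k by (induction k) auto
  ultimately show "t' = t" by (metis of_nat_eq_iff)
qed

section \<open>The core inverse\<close>

lemma mat_inv_eqI:
  assumes A: "A \<in> carrier_mat n n" and B: "B \<in> carrier_mat n n"
    and AB: "A * B = 1\<^sub>m n" and BA: "B * A = 1\<^sub>m n"
  shows "mat_inv A = B"
  unfolding mat_inv_def
proof (rule the_equality)
  show "B \<in> carrier_mat (dim_row A) (dim_row A) \<and> inverts_mat A B \<and> inverts_mat B A"
    using assms by (auto simp: inverts_mat_def)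
  fix C assume "C \<in> carrier_mat (dim_row A) (dim_row A) \<and> inverts_mat A C \<and> inverts_mat C A"
  then have C: "C \<in> carrier_mat n n" "A * C = 1\<^sub>m n" using A by (auto simp: inverts_mat_def)
  have "C = B * A * C" using BA C by simp
  also have "\<dots> = B" using A B C by (simp add: assoc_mult_mat[of _ n n _ n _ n] right_mult_one_mat[of _ n n])
  finally show "C = B" .
qed

text \<open>The premise \<open>X * (A * A) = A\<close> serves uniqueness: it makes \<open>A\<close>
  injective on its own range.\<close>

lemma dc_core_eqI:
  assumes A: "A \<in> carrier_mat n n" and X: "X \<in> carrier_mat n n" and AXA: "A * (X * A) = A"
    and AXX: "A * (X * X) = X" and herm: "adj (A * X) = A * X" and XAA: "X * (A * A) = A"
  shows "dc_core A = X"
  unfolding dc_core_def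
proof (rule the_equality)
  note sq = assoc_mult_mat[of _ n n _ n _ n] mult_carrier_mat[of _ n n _ n] adj_mult[of _ n n _ n]
  have pow2: "Y ^\<^sub>m 2 = Y * Y" if "Y \<in> carrier_mat n n" for Y :: "complex dualnum mat"
    using that by (simp add: numeral_2_eq_2)
  show "X \<in> carrier_mat (dim_row A) (dim_row A) \<and>
     A * X * A = A \<and> A * X ^\<^sub>m 2 = X \<and> adj (A * X) = A * X"
    using A X AXA AXX herm by (auto simp: pow2[OF X] sq)
  fix Y assume "Y \<in> carrier_mat (dim_row A) (dim_row A) \<and>
     A * Y * A = A \<and> A * Y ^\<^sub>m 2 = Y \<and> adj (A * Y) = A * Y"
  then have Y: "Y \<in> carrier_mat n n" and AYA: "A * (Y * A) = A" and hermY: "adj (A * Y) = A * Y"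
    and AYY: "A * (Y * Y) = Y"
    using A by (auto simp: pow2 sq)
  \<comment> \<open>\<open>A * Y\<close> is absorbed by \<open>A * X\<close> on the left; taking
    adjoints moves it to the right, where \<open>A * X * A = A\<close> leaves just
    \<open>A * Y\<close>.\<close>
  have "(A * Y) * (A * X) = A * (Y * A) * X" using A X Y by (simp add: sq)
  then have "A * X = (A * Y) * (A * X)" by (simp only: AYA)
  from arg_cong[OF this, of adj] have "adj (A * X) = adj (A * X) * adj (A * Y)"
    unfolding adj_mult[OF mult_carrier_mat[OF A Y] mult_carrier_mat[OF A X]] .
  then have "A * X = (A * X) * (A * Y)" by (simp only: herm hermY)
  also have "\<dots> = A * (X * A) * Y" using A X Y by (simp add: sq)
  finally have AX: "A * X = A * Y" using AXA by simp
  \<comment> \<open>\<open>X - Y\<close> is both in the range and in the kernel of \<open>A\<close>.\<close>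
  define E where "E = X * X - Y * Y"
  have E: "E \<in> carrier_mat n n"
    unfolding E_def by (rule minus_carrier_mat[OF mult_carrier_mat[OF Y Y]])
  have AE: "A * E = X - Y"
    using A X Y AXX AYY by (simp add: E_def mult_minus_distrib_mat[of _ n n _ n] sq)
  have "X - Y = X * (A * A) * E" unfolding XAA by (simp add: AE)
  also have "\<dots> = X * (A * (X - Y))" using A X E by (simp add: sq AE)
  also have "A * (X - Y) = 0\<^sub>m n n"
    using A X Y AX by (simp add: mult_minus_distrib_mat[of _ n n _ n] minus_r_inv_mat[of _ n n] sq)
  finally have "X - Y = 0\<^sub>m n n" using X by simp
  show "Y = X"
  proof (rule eq_matI)
    fix i j assume "i < dim_row X" "j < dim_col X"
    then show "Y $$ (i, j) = X $$ (i, j)"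
      using arg_cong[OF \<open>X - Y = 0\<^sub>m n n\<close>, of "\<lambda>M. M $$ (i, j)"] X Y by simp
  qed (use X Y in auto)
qed

section \<open>Inverses of the blocks\<close>

text \<open>The Neumann series of the inverse stops after the first order, since eps squared is
  0.\<close>

lemma dual_mat_inverse:
  fixes K1 :: "'a :: comm_ring_1 mat"
  assumes K: "K1 \<in> carrier_mat r r" "K2 \<in> carrier_mat r r" and J: "J \<in> carrier_mat r r"
    and KJ: "K1 * J = 1\<^sub>m r" and JK: "J * K1 = 1\<^sub>m r"
  shows "dual_mat K1 K2 * (of_std_mat J - eps \<cdot>\<^sub>m of_std_mat (J * K2 * J)) = 1\<^sub>m r"
    and "(of_std_mat J - eps \<cdot>\<^sub>m of_std_mat (J * K2 * J)) * dual_mat K1 K2 = 1\<^sub>m r"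
proof -
  let ?I = "of_std_mat J - eps \<cdot>\<^sub>m of_std_mat (J * K2 * J)"
  have Ip: "std_mat ?I = J" "inf_mat ?I = - (J * K2 * J)"
    using J K by (auto intro!: eq_matI)
  note Kp = dual_mat_parts[OF K]
  note sq = assoc_mult_mat[of _ r r _ r _ r] mult_carrier_mat[of _ r r _ r]
  have KJ': "K1 * (J * Q) = Q" if "Q \<in> carrier_mat r r" for Q
    using that K J KJ by (simp flip: assoc_mult_mat[of _ r r _ r _ r])
  have c: "dual_mat K1 K2 \<in> carrier_mat r r" "?I \<in> carrier_mat r r" using K J by (auto simp: sq)
  show "dual_mat K1 K2 * ?I = 1\<^sub>m r"
  proof (rule dual_mat_eqI[of _ r r])
    show "std_mat (dual_mat K1 K2 * ?I) = std_mat (1\<^sub>m r)"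
      by (simp only: std_mat_mult[OF c] Kp Ip KJ std_inf_mat_simps)
    have "inf_mat (dual_mat K1 K2 * ?I) = - (K2 * J) + K2 * J"
      using K J by (simp only: inf_mat_mult[OF c] Kp Ip) (simp add: sq KJ')
    then show "inf_mat (dual_mat K1 K2 * ?I) = inf_mat (1\<^sub>m r)"
      using K J by (simp add: sq uminus_l_inv_mat[of _ r r])
  qed (use c in \<open>auto simp: sq\<close>)
  show "?I * dual_mat K1 K2 = 1\<^sub>m r"
  proof (rule dual_mat_eqI[of _ r r])
    show "std_mat (?I * dual_mat K1 K2) = std_mat (1\<^sub>m r)"
      by (simp only: std_mat_mult[OF c(2,1)] Kp Ip JK std_inf_mat_simps)
    have "inf_mat (?I * dual_mat K1 K2) = J * K2 + - (J * K2 * J) * K1"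
      by (simp only: inf_mat_mult[OF c(2,1)] Kp Ip)
    also have "\<dots> = J * K2 + - (J * K2)"
      using K J JK by (simp add: sq right_mult_one_mat[of _ r r])
    also have "\<dots> = 0\<^sub>m r r" using K J by (intro eq_matI) auto
    finally show "inf_mat (?I * dual_mat K1 K2) = inf_mat (1\<^sub>m r)" by simp
  qed (use c in \<open>auto simp: sq\<close>)
qed

text \<open>First-order expansion of 1 / (a + eps b), embedded in the dual complex numbers.\<close>

definition dual_inverse :: "real dualnum \<Rightarrow> complex dualnum" where
  "dual_inverse x = dc_of_dual (DualNum (1 / std_part x) (- inf_part x / (std_part x)\<^sup>2))"

lemma dual_inverse:
  assumes "appreciable x"
  shows "dc_of_dual x * dual_inverse x = 1" "dual_inverse x * dc_of_dual x = 1"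
proof -
  obtain a b where x: "x = DualNum a b" by (cases x)
  with assms have "a \<noteq> 0" by (simp add: appreciable_def)
  then have "complex_of_real a * (- complex_of_real b / (complex_of_real a)\<^sup>2)
      + complex_of_real b * (1 / complex_of_real a) = 0"
    by (simp add: power2_eq_square)
  with \<open>a \<noteq> 0\<close> show "dc_of_dual x * dual_inverse x = 1"
    by (simp add: x dual_inverse_def dualnum_eq_iff)
  then show "dual_inverse x * dc_of_dual x = 1" by (simp add: mult.commute)
qed

lemma mat_diag_dual_inverse:
  assumes "\<forall>i<r. appreciable (\<mu> i)"
  shows "mat_diag r (\<lambda>i. dc_of_dual (\<mu> i)) * mat_diag r (\<lambda>i. dual_inverse (\<mu> i)) = 1\<^sub>m r"
    and "mat_diag r (\<lambda>i. dual_inverse (\<mu> i)) * mat_diag r (\<lambda>i. dc_of_dual (\<mu> i)) = 1\<^sub>m r"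
  using assms dual_inverse unfolding mat_diag_diag
  by (auto intro!: eq_matI simp: mat_diag_def)

text \<open>The top left block of the equation reads S K S Z1 = S, and cancelling the invertible
  \<open>S\<close> gives \<open>K\<close> a right inverse. Its standard part is a right inverse over
  the complex numbers, hence two-sided.\<close>

lemma CM_invertible_block:
  fixes D W Z S K L M N :: "complex dualnum mat"
  assumes S: "S = mat_diag r (\<lambda>i. dc_of_dual (\<mu> i))" and \<mu>: "\<forall>i<r. appreciable (\<mu> i)"
    and blocks: "K \<in> carrier_mat r r" "L \<in> carrier_mat r k" "M \<in> carrier_mat k r" "N \<in> carrier_mat k k"
    and D: "D = four_block_mat S (0\<^sub>m r k) (0\<^sub>m k r) (0\<^sub>m k k)"
    and W: "W = four_block_mat K L M N" and Z: "Z \<in> carrier_mat (r + k) (r + k)"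
    and DWDZ: "D * (W * (D * Z)) = D"
  obtains J where "J \<in> carrier_mat r r" "std_mat K * J = 1\<^sub>m r" "J * std_mat K = 1\<^sub>m r"
proof -
  obtain Z1 Z2 Z3 Z4 where "split_block Z r r = (Z1, Z2, Z3, Z4)" by (metis prod_cases4)
  note Zb = split_block[OF this, of k k]
  have Z: "Z1 \<in> carrier_mat r r" "Z2 \<in> carrier_mat r k" "Z3 \<in> carrier_mat k r" "Z4 \<in> carrier_mat k k"
    "Z = four_block_mat Z1 Z2 Z3 Z4" using Zb Z by auto
  have Sc: "S \<in> carrier_mat r r" by (simp add: S)
  let ?i = "mat_diag r (\<lambda>i. dual_inverse (\<mu> i))"
  have iS: "?i * S = 1\<^sub>m r"
    using mat_diag_dual_inverse(2)[OF \<mu>] by (simp add: S)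
  note m = mult_four_block_mat[of _ r r _ k _ k _ _ r _ k]
  have DZ: "D * Z = four_block_mat (S * Z1) (S * Z2) (0\<^sub>m k r) (0\<^sub>m k k)"
    unfolding D Z(5) using Sc Z(1-4) mult_carrier_mat[OF Sc Z(1)] mult_carrier_mat[OF Sc Z(2)]
    by (simp add: m left_mult_zero_mat[of _ r] left_mult_zero_mat[of _ k])
  note c1 = mult_carrier_mat[OF Sc Z(1)] mult_carrier_mat[OF Sc Z(2)]
  have WDZ: "W * (D * Z) = four_block_mat (K * (S * Z1)) (K * (S * Z2)) (M * (S * Z1)) (M * (S * Z2))"
    unfolding DZ W using blocks c1
      mult_carrier_mat[OF blocks(1) c1(1)] mult_carrier_mat[OF blocks(1) c1(2)]
      mult_carrier_mat[OF blocks(3) c1(1)] mult_carrier_mat[OF blocks(3) c1(2)]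
    by (simp add: m right_mult_zero_mat[of _ _ k])
  note c2 = mult_carrier_mat[OF blocks(1) c1(1)] mult_carrier_mat[OF blocks(1) c1(2)]
      mult_carrier_mat[OF blocks(3) c1(1)] mult_carrier_mat[OF blocks(3) c1(2)]
  note c3 = mult_carrier_mat[OF Sc c2(1)] mult_carrier_mat[OF Sc c2(2)]
  have "D * (W * (D * Z)) = four_block_mat (S * (K * (S * Z1))) (S * (K * (S * Z2))) (0\<^sub>m k r) (0\<^sub>m k k)"
    unfolding WDZ unfolding D using Sc c2 c3
    by (simp add: m left_mult_zero_mat[of _ r] left_mult_zero_mat[of _ k])
  then have "four_block_mat (S * (K * (S * Z1))) (S * (K * (S * Z2))) (0\<^sub>m k r) (0\<^sub>m k k)
      = four_block_mat S (0\<^sub>m r k) (0\<^sub>m k r) (0\<^sub>m k k)"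
    using DWDZ D by simp
  then have "S * (K * (S * Z1)) = S"
    by (rule four_block_mat_inj(1)[where ?r1.0 = r and ?c1.0 = r and ?r2.0 = k and ?c2.0 = k])
      (use Sc c3 in auto)
  then have "?i * S * (K * (S * Z1)) = ?i * S"
    using assoc_mult_mat[OF _ Sc c2(1), of ?i r] by simp
  then have "K * (S * Z1) = 1\<^sub>m r" unfolding iS left_mult_one_mat[OF c2(1)] .
  then have "std_mat (K * (S * Z1)) = 1\<^sub>m r" by simp
  then have 1: "std_mat K * std_mat (S * Z1) = 1\<^sub>m r"
    by (simp only: std_mat_mult[OF blocks(1) c1(1)])
  have c: "std_mat K \<in> carrier_mat r r" "std_mat (S * Z1) \<in> carrier_mat r r"
    using blocks(1) c1(1) by simp_all
  show ?thesis by (rule that[OF c(2) 1 mat_mult_left_right_inverse[OF c 1]])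
qed

text \<open>Inside the conjugation by \<open>P\<close> the product of the two block matrices is
  \<open>E\<close>, the orthogonal projection onto the first \<open>r\<close> coordinates, which
  fixes both factors from the left. The first conclusion is kept because it supplies the inner
  inverse for the rank.\<close>

lemma block_core:
  fixes K L S :: "complex dualnum mat"
  assumes P: "unitary (r + k) P"
    and S: "S \<in> carrier_mat r r" and Si: "Si \<in> carrier_mat r r" "S * Si = 1\<^sub>m r" "Si * S = 1\<^sub>m r"
    and K: "K \<in> carrier_mat r r" and Ki: "Ki \<in> carrier_mat r r" "K * Ki = 1\<^sub>m r" "Ki * K = 1\<^sub>m r"
    and L: "L \<in> carrier_mat r k"
  defines "A \<equiv> P * four_block_mat (S * K) (S * L) (0\<^sub>m k r) (0\<^sub>m k k) * adj P"
    and "X \<equiv> P * four_block_mat (Ki * Si) (0\<^sub>m r k) (0\<^sub>m k r) (0\<^sub>m k k) * adj P"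
  shows "A * (X * A) = A" "dc_core A = X"
proof -
  let ?n = "r + k"
  define B where "B = four_block_mat (S * K) (S * L) (0\<^sub>m k r) (0\<^sub>m k k)"
  define Y where "Y = four_block_mat (Ki * Si) (0\<^sub>m r k) (0\<^sub>m k r) (0\<^sub>m k k)"
  define E where "E = four_block_mat (1\<^sub>m r) (0\<^sub>m r k) (0\<^sub>m k r) (0\<^sub>m k k :: complex dualnum mat)"
  note sq = assoc_mult_mat[of _ ?n ?n _ ?n _ ?n] mult_carrier_mat[of _ ?n ?n _ ?n]
    adj_mult[of _ ?n ?n _ ?n] unitary_cancel[of ?n _ _ ?n]
  note c0 = mult_carrier_mat[OF S K] mult_carrier_mat[OF S L] mult_carrier_mat[OF Ki(1) Si(1)]
  have c: "B \<in> carrier_mat ?n ?n" "Y \<in> carrier_mat ?n ?n" "E \<in> carrier_mat ?n ?n"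
    using four_block_carrier_mat[OF c0(1) zero_carrier_mat[of k k]]
      four_block_carrier_mat[OF c0(3) zero_carrier_mat[of k k]]
      four_block_carrier_mat[OF one_carrier_mat[of r] zero_carrier_mat[of k k]]
    by (simp_all add: B_def Y_def E_def)
  note Pc = unitary_carrier[OF P]
  have A: "A = P * (B * adj P)" and X: "X = P * (Y * adj P)"
    using Pc c unfolding A_def X_def B_def[symmetric] Y_def[symmetric] by (simp_all add: sq)
  note m = mult_four_block_mat[of _ r r _ k _ k _ _ r _ k]
    left_mult_zero_mat[of _ r] left_mult_zero_mat[of _ k]
    right_mult_zero_mat[of _ _ r] right_mult_zero_mat[of _ _ k]
    left_add_zero_mat[of _ r k] right_add_zero_mat[of _ r k]
    left_add_zero_mat[of _ r r] right_add_zero_mat[of _ r r]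
  note a = assoc_mult_mat[of _ r r _ r _ r] assoc_mult_mat[of _ r r _ r _ k]
    mult_carrier_mat[of _ r r _ r] mult_carrier_mat[of _ r r _ k]
    left_mult_one_mat[of _ r r] right_mult_one_mat[of _ r r] left_mult_one_mat[of _ r k]
  have canc: "K * (Ki * Q) = Q" "Ki * (K * Q) = Q" "S * (Si * Q) = Q" "Si * (S * Q) = Q"
    if "Q \<in> carrier_mat r q" for Q q
    using that S Si K Ki
    by (simp_all flip: assoc_mult_mat[OF K Ki(1)] assoc_mult_mat[OF Ki(1) K]
        assoc_mult_mat[OF S Si(1)] assoc_mult_mat[OF Si(1) S])
  have BY: "B * Y = E"
    unfolding B_def Y_def E_def using S Si K Ki L by (simp add: m a canc[of _ r])
  have EE: "E * B = B" "E * Y = Y"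
    unfolding B_def Y_def E_def using S Si K Ki L by (simp_all add: m a)
  \<comment> \<open>This acts as the identity on matrices whose lower rows vanish, such as
    \<open>B\<close>.\<close>
  have "Y * B = four_block_mat (1\<^sub>m r) (Ki * L) (0\<^sub>m k r) (0\<^sub>m k k)"
    unfolding B_def Y_def using S Si K Ki L by (simp add: m a canc[of _ r] canc[of _ k])
  then have YBB: "Y * B * B = B"
    unfolding B_def using S Si K Ki L by (simp add: m a mult_carrier_mat[OF Ki(1) L])
  have "adj E = E"
    unfolding E_def
    using adj_four_block[of "1\<^sub>m r :: complex dualnum mat" r r "0\<^sub>m r k" k "0\<^sub>m k r" k "0\<^sub>m k k"]
    by simp
  have AX: "A * X = P * (E * adj P)"
    unfolding A X BY[symmetric] using Pc c P by (simp add: sq)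
  show AXA: "A * (X * A) = A"
  proof -
    have "A * (X * A) = A * X * A" using Pc c unfolding A X by (simp add: sq)
    also have "\<dots> = P * (E * B * adj P)" unfolding AX unfolding A using Pc c P by (simp add: sq)
    finally show ?thesis unfolding EE A .
  qed
  show "dc_core A = X"
  proof (rule dc_core_eqI[OF _ _ AXA])
    show "A \<in> carrier_mat ?n ?n" "X \<in> carrier_mat ?n ?n" using Pc c unfolding A X by (simp_all add: sq)
    show "A * (X * X) = X"
    proof -
      have "A * (X * X) = A * X * X" using Pc c unfolding A X by (simp add: sq)
      also have "\<dots> = P * (E * Y * adj P)" unfolding AX unfolding X using Pc c P by (simp add: sq)
      finally show ?thesis unfolding EE X .
    qed
    show "adj (A * X) = A * X" unfolding AX using Pc c \<open>adj E = E\<close> by (simp add: sq)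
    have "X * (A * A) = P * (Y * B * B * adj P)" unfolding A X using Pc c P by (simp add: sq)
    then show "X * (A * A) = A" unfolding YBB A .
  qed
qed

text \<open>Both equations are parts of one: the top left block of W W^* = 1, that is, K K^* + L L^*
  = 1, read at order 0 and at order 1 in eps.\<close>

lemma unitary_top_row_blocks:
  fixes K L :: "complex dualnum mat"
  assumes W: "unitary (r + k) (four_block_mat K L M N)"
    and blocks: "K \<in> carrier_mat r r" "L \<in> carrier_mat r k" "M \<in> carrier_mat k r" "N \<in> carrier_mat k k"
  shows "std_mat K * adj (std_mat K) + std_mat L * adj (std_mat L) = 1\<^sub>m r"
    and "std_mat K * adj (inf_mat K) + inf_mat K * adj (std_mat K) + std_mat L * adj (inf_mat L)
      + inf_mat L * adj (std_mat L) = 0\<^sub>m r r"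
proof -
  note ab = adj_carrier[OF blocks(1)] adj_carrier[OF blocks(2)] adj_carrier[OF blocks(3)] adj_carrier[OF blocks(4)]
  have "four_block_mat K L M N * four_block_mat (adj K) (adj M) (adj L) (adj N)
    = four_block_mat (1\<^sub>m r) (0\<^sub>m r k) (0\<^sub>m k r) (1\<^sub>m k)"
    using W by (simp add: unitary_def adj_four_block[OF blocks])
  then have 1: "K * adj K + L * adj L = 1\<^sub>m r"
    unfolding mult_four_block_mat[OF blocks ab(1) ab(3) ab(2) ab(4)]
    by (rule four_block_mat_inj(1)[where ?r1.0 = r and ?c1.0 = r and ?r2.0 = k and ?c2.0 = k])
      (use blocks ab in \<open>auto intro!: add_carrier_mat mult_carrier_mat\<close>)
  have c: "K * adj K \<in> carrier_mat r r" "L * adj L \<in> carrier_mat r r"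
    using blocks ab by (auto intro: mult_carrier_mat)
  have add: "map_mat f (Q + Q') = map_mat f Q + map_mat f Q'"
    if "Q \<in> carrier_mat r r" "Q' \<in> carrier_mat r r" "\<And>x y. f (x + y) = f x + f y"
    for f :: "complex dualnum \<Rightarrow> complex" and Q Q'
    using that by (intro eq_matI) auto
  note parts = std_mat_mult[OF blocks(1) ab(1)] std_mat_mult[OF blocks(2) ab(2)]
    inf_mat_mult[OF blocks(1) ab(1)] inf_mat_mult[OF blocks(2) ab(2)]
  have "std_mat (K * adj K + L * adj L) = 1\<^sub>m r" "inf_mat (K * adj K + L * adj L) = 0\<^sub>m r r"
    by (simp_all add: 1)
  then have "std_mat (K * adj K) + std_mat (L * adj L) = 1\<^sub>m r"
    and 2: "inf_mat (K * adj K) + inf_mat (L * adj L) = 0\<^sub>m r r"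
    by (simp_all add: add[OF c])
  then show "std_mat K * adj (std_mat K) + std_mat L * adj (std_mat L) = 1\<^sub>m r"
    by (simp add: parts)
  show "std_mat K * adj (inf_mat K) + inf_mat K * adj (std_mat K) + std_mat L * adj (inf_mat L)
      + inf_mat L * adj (std_mat L) = 0\<^sub>m r r"
    using 2 blocks
    by (subst assoc_add_mat[of _ r r]) (auto simp: parts intro!: add_carrier_mat mult_carrier_mat)
qed

lemma four_block_top_left_diff:
  fixes X Y :: "'a :: comm_ring_1 dualnum mat"
  assumes "X \<in> carrier_mat r r" "Y \<in> carrier_mat r r"
  shows "four_block_mat X (0\<^sub>m r k) (0\<^sub>m k r) (0\<^sub>m k k) - eps \<cdot>\<^sub>m four_block_mat Y (0\<^sub>m r k) (0\<^sub>m k r) (0\<^sub>m k k)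
    = four_block_mat (X - eps \<cdot>\<^sub>m Y) (0\<^sub>m r k) (0\<^sub>m k r) (0\<^sub>m k k)"
  using assms by (intro eq_matI) auto

lemma of_std_mat_four_block_top_left:
  assumes "X \<in> carrier_mat r r"
  shows "of_std_mat (four_block_mat X (0\<^sub>m r k) (0\<^sub>m k r) (0\<^sub>m k k))
    = four_block_mat (of_std_mat X) (0\<^sub>m r k) (0\<^sub>m k r) (0\<^sub>m k k)"
  using assms by (intro eq_matI) (auto simp: dualnum_eq_iff)

text \<open>Passes between the two displayed forms of the core inverse: one keeps the dual inverse
  of \<open>S\<close> as a factor, the other expands it and collects the terms of order 1.\<close>

lemma core_block_parts:
  fixes J K2 :: "complex mat"
  assumes J: "J \<in> carrier_mat r r" and K2: "K2 \<in> carrier_mat r r" and \<mu>: "\<forall>i<r. appreciable (\<mu> i)"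
  defines "S \<equiv> mat_diag r (\<lambda>i. dc_of_dual (\<mu> i))"
  shows "(of_std_mat J - eps \<cdot>\<^sub>m of_std_mat (J * K2 * J)) * mat_inv S
      = of_std_mat J * mat_inv S - eps \<cdot>\<^sub>m (of_std_mat (J * K2 * J) * mat_inv S)" (is "?C = ?C1")
    and "(of_std_mat J - eps \<cdot>\<^sub>m of_std_mat (J * K2 * J)) * mat_inv S
      = of_std_mat (J * mat_inv (std_mat S))
        - eps \<cdot>\<^sub>m of_std_mat (J * K2 * J * mat_inv (std_mat S)
            + J * (mat_inv (std_mat S) ^\<^sub>m 2) * inf_mat S)" (is "?C = ?C2")
    and "mat_inv S = mat_diag r (\<lambda>i. dual_inverse (\<mu> i))"
    and "mat_inv (std_mat S) \<in> carrier_mat r r"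
proof -
  let ?Si = "mat_diag r (\<lambda>i. dual_inverse (\<mu> i))"
  let ?Ssi = "mat_diag r (\<lambda>i. complex_of_real (1 / std_part (\<mu> i)))"
  have ne: "std_part (\<mu> i) \<noteq> 0" if "i < r" for i using \<mu> that by (simp add: appreciable_def)
  have parts: "std_mat S = mat_diag r (\<lambda>i. complex_of_real (std_part (\<mu> i)))"
    "inf_mat S = mat_diag r (\<lambda>i. complex_of_real (inf_part (\<mu> i)))"
    "std_mat ?Si = ?Ssi"
    "inf_mat ?Si = mat_diag r (\<lambda>i. complex_of_real (- inf_part (\<mu> i) / (std_part (\<mu> i))\<^sup>2))"
    by (auto simp: S_def mat_diag_def dual_inverse_def dualnum.map_sel intro!: eq_matI)
  show Si: "mat_inv S = ?Si"
    unfolding S_def by (rule mat_inv_eqI[OF _ _ mat_diag_dual_inverse[OF \<mu>]]) simp_all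
  have Ssi: "mat_inv (std_mat S) = ?Ssi"
    unfolding parts using ne
    by (intro mat_inv_eqI[of _ r]) (simp_all, auto simp: mat_diag_def intro!: eq_matI)
  show "mat_inv (std_mat S) \<in> carrier_mat r r" unfolding Ssi by simp
  have JKJ: "J * K2 * J \<in> carrier_mat r r" using J K2 by (simp add: mult_carrier_mat[of _ r r _ r])
  have c: "of_std_mat J \<in> carrier_mat r r" "of_std_mat (J * K2 * J) \<in> carrier_mat r r"
    "eps \<cdot>\<^sub>m of_std_mat (J * K2 * J) \<in> carrier_mat r r" "?Si \<in> carrier_mat r r"
    using J JKJ by simp_all
  show "?C = ?C1"
    unfolding Si using c by (simp add: minus_mult_distrib_mat[OF c(1,3,4)] mult_smult_assoc_mat[OF c(2,4)])
  have c': "of_std_mat J - eps \<cdot>\<^sub>m of_std_mat (J * K2 * J) \<in> carrier_mat r r" by (rule minus_carrier_mat[OF c(3)])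
  have Ip: "std_mat (of_std_mat J - eps \<cdot>\<^sub>m of_std_mat (J * K2 * J)) = J"
    "inf_mat (of_std_mat J - eps \<cdot>\<^sub>m of_std_mat (J * K2 * J)) = - (J * K2 * J)"
    using J JKJ by (auto intro!: eq_matI)
  \<comment> \<open>The derivative of the reciprocal, which accounts for the last summand of the
    expanded form.\<close>
  have pow: "?Ssi ^\<^sub>m 2 * inf_mat S = - inf_mat ?Si"
    unfolding parts by (auto simp: numeral_2_eq_2 power2_eq_square mat_diag_def intro!: eq_matI simp flip: mat_diag_def)
      (auto simp: mat_diag_def)
  have d: "?Ssi \<in> carrier_mat r r" "inf_mat S \<in> carrier_mat r r" "inf_mat ?Si \<in> carrier_mat r r"
    "?Ssi ^\<^sub>m 2 \<in> carrier_mat r r"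
    by (simp_all add: parts)
  define G where "G = J * K2 * J * ?Ssi + J * (?Ssi ^\<^sub>m 2) * inf_mat S"
  have G: "G = J * K2 * J * ?Ssi - J * inf_mat ?Si"
    using J JKJ d(3) unfolding G_def assoc_mult_mat[OF J d(4) d(2)] pow
    by (intro eq_matI) auto
  have JS: "J * ?Ssi \<in> carrier_mat r r" "G \<in> carrier_mat r r"
    using mult_carrier_mat[OF J d(1)] minus_carrier_mat[OF mult_carrier_mat[OF J d(3)]]
    by (simp_all add: G)
  have "?C = of_std_mat (J * ?Ssi) - eps \<cdot>\<^sub>m of_std_mat G"
  proof (rule dual_mat_eqI[of _ r r])
    show "?C \<in> carrier_mat r r" unfolding Si using mult_carrier_mat[OF c' c(4)] .
    show "of_std_mat (J * ?Ssi) - eps \<cdot>\<^sub>m of_std_mat G \<in> carrier_mat r r"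
      using JS by (intro minus_carrier_mat) simp
    have "std_mat (of_std_mat (J * ?Ssi) - eps \<cdot>\<^sub>m of_std_mat G) = J * ?Ssi"
      "inf_mat (of_std_mat (J * ?Ssi) - eps \<cdot>\<^sub>m of_std_mat G) = - G"
      using JS by (auto intro!: eq_matI)
    moreover have "std_mat ?C = J * ?Ssi"
      unfolding Si by (simp only: std_mat_mult[OF c' c(4)] Ip parts)
    moreover have "inf_mat ?C = J * inf_mat ?Si + - (J * K2 * J) * ?Ssi"
      unfolding Si by (simp only: inf_mat_mult[OF c' c(4)] Ip parts(3))
    moreover have "\<dots> = - G"
      using mult_carrier_mat[OF JKJ d(1)] mult_carrier_mat[OF J d(3)] JKJ d(1) unfolding G
      by (intro eq_matI) auto
    ultimately show "std_mat ?C = std_mat (of_std_mat (J * ?Ssi) - eps \<cdot>\<^sub>m of_std_mat G)"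
      "inf_mat ?C = inf_mat (of_std_mat (J * ?Ssi) - eps \<cdot>\<^sub>m of_std_mat G)" by simp_all
  qed
  then show "?C = ?C2" unfolding Ssi G_def .
qed

theorem theorem4p11:
  fixes A :: "complex dualnum mat" and n r :: nat
  assumes "A \<in> DC_CM n"
    and "r = dual_rank A"
  shows "\<exists>(U :: complex dualnum mat) (K1 :: complex mat) (K2 :: complex mat)
      (L1 :: complex mat) (L2 :: complex mat) (\<mu> :: nat \<Rightarrow> real dualnum).
    U \<in> DC_U n \<and>
    K1 \<in> carrier_mat r r \<and> K2 \<in> carrier_mat r r \<and> invertible_mat K1 \<and>
    L1 \<in> carrier_mat r (n - r) \<and> L2 \<in> carrier_mat r (n - r) \<and>
    K1 * adj K1 + L1 * adj L1 = 1\<^sub>m r \<and>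
    K1 * adj K2 + K2 * adj K1 + L1 * adj L2 + L2 * adj L1 = 0\<^sub>m r r \<and>
    (\<forall>i<r. 0 < \<mu> i \<and> appreciable (\<mu> i)) \<and>
    (\<forall>i j. i \<le> j \<longrightarrow> j < r \<longrightarrow> \<mu> j \<le> \<mu> i) \<and>
    (let S = mat_diag r (\<lambda>i. dc_of_dual (\<mu> i));
         Ss = map_mat std_part S;
         Sd = map_mat inf_part S
     in
       A = U * four_block_mat
                 (S * (of_std_mat K1 + eps \<cdot>\<^sub>m of_std_mat K2))
                 (S * (of_std_mat L1 + eps \<cdot>\<^sub>m of_std_mat L2))
                 (0\<^sub>m (n - r) r) (0\<^sub>m (n - r) (n - r)) * adj U \<and>
       dc_core A =
         U * (four_block_mat
                (of_std_mat (mat_inv K1) * mat_inv S)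
                (0\<^sub>m r (n - r)) (0\<^sub>m (n - r) r) (0\<^sub>m (n - r) (n - r))
              - eps \<cdot>\<^sub>m four_block_mat
                (of_std_mat (mat_inv K1 * K2 * mat_inv K1) * mat_inv S)
                (0\<^sub>m r (n - r)) (0\<^sub>m (n - r) r) (0\<^sub>m (n - r) (n - r))) * adj U \<and>
       dc_core A =
         U * (of_std_mat (four_block_mat
                (mat_inv K1 * mat_inv Ss)
                (0\<^sub>m r (n - r)) (0\<^sub>m (n - r) r) (0\<^sub>m (n - r) (n - r)))
              - eps \<cdot>\<^sub>m of_std_mat (four_block_mat
                (mat_inv K1 * K2 * mat_inv K1 * mat_inv Ss
                  + mat_inv K1 * (mat_inv Ss ^\<^sub>m 2) * Sd)
                (0\<^sub>m r (n - r)) (0\<^sub>m (n - r) r) (0\<^sub>m (n - r) (n - r)))) * adj U)"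
proof -
  have A: "A \<in> carrier_mat n n" using assms(1) by (simp add: DC_CM_def)
  obtain Z where Z: "Z \<in> carrier_mat n n" "A * (A * Z) = A"
    using range_mat_square[OF A] assms(1) by (auto simp: DC_CM_def)
  obtain P V t \<mu> where svd: "dual_svd A P V t \<mu>" and app: "\<forall>i<t. appreciable (\<mu> i)"
    using CM_dual_svd[OF assms(1)] by blast
  define k where "k = n - t"
  define S where "S = mat_diag t (\<lambda>i. dc_of_dual (\<mu> i))"
  define D where "D = four_block_mat S (0\<^sub>m t k) (0\<^sub>m k t) (0\<^sub>m k k)"
  have P: "unitary n P" and V: "unitary n V" and tn: "t \<le> n" and A_eq: "A = P * D * adj V"
    and pos: "\<And>i. i < t \<Longrightarrow> 0 < \<mu> i" and mono: "\<And>i j. i \<le> j \<Longrightarrow> j < t \<Longrightarrow> \<mu> j \<le> \<mu> i"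
    using svd A by (auto simp: dual_svd_def Let_def DC_U_iff_unitary D_def S_def k_def)
  have n: "n = t + k" using tn by (simp add: k_def)
  have Sc: "S \<in> carrier_mat t t" by (simp add: S_def)
  have Dc: "D \<in> carrier_mat n n"
    unfolding D_def n by (rule four_block_carrier_mat[OF Sc zero_carrier_mat])
  note Pc = unitary_carrier[OF P] note Vc = unitary_carrier[OF V]
  note sq = assoc_mult_mat[of _ n n _ n _ n] mult_carrier_mat[of _ n n _ n] unitary_cancel[of n _ _ n]
  \<comment> \<open>Replacing \<open>adj V\<close> by \<open>W * adj P\<close> puts the same unitary
    matrix on both sides of \<open>A\<close>, the form in which the core inverse is computed
    blockwise.\<close>
  define W where "W = adj V * P"
  have W: "unitary n W" unfolding W_def by (intro unitary_mult unitary_adj P V)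
  obtain K L M N where "split_block W t t = (K, L, M, N)" by (metis prod_cases4)
  note Wb = split_block[OF this, of k k]
  have blocks: "K \<in> carrier_mat t t" "L \<in> carrier_mat t k" "M \<in> carrier_mat k t" "N \<in> carrier_mat k k"
    and W_eq: "W = four_block_mat K L M N"
    using Wb unitary_carrier[OF W] n by auto
  define Y where "Y = adj V * Z * V"
  have Y: "Y \<in> carrier_mat (t + k) (t + k)" using Z Vc unfolding n[symmetric] Y_def by (simp add: sq)
  have "D * (W * (D * Y)) = adj P * (A * (A * Z)) * V"
    using Pc Vc Dc Z(1) P V unfolding A_eq W_def Y_def by (simp add: sq)
  also have "\<dots> = adj P * (P * D * adj V) * V" unfolding Z(2) by (simp only: A_eq)
  also have "\<dots> = D * (adj V * V)" using Pc Vc Dc P by (simp add: sq)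
  also have "\<dots> = D" using V Dc by (simp add: unitary_def right_mult_one_mat[of _ n n])
  finally obtain J where J: "J \<in> carrier_mat t t" "std_mat K * J = 1\<^sub>m t" "J * std_mat K = 1\<^sub>m t"
    using CM_invertible_block[OF S_def app blocks D_def W_eq Y] by blast
  have Kp: "std_mat K \<in> carrier_mat t t" "inf_mat K \<in> carrier_mat t t" using blocks by simp_all
  have Jinv: "mat_inv (std_mat K) = J" by (rule mat_inv_eqI[OF Kp(1) J])
  define Ki where "Ki = of_std_mat J - eps \<cdot>\<^sub>m of_std_mat (J * inf_mat K * J)"
  have JKJ: "J * inf_mat K * J \<in> carrier_mat t t" by (rule mult_carrier_mat[OF mult_carrier_mat[OF J(1) Kp(2)] J(1)])
  have Ki: "Ki \<in> carrier_mat t t" "K * Ki = 1\<^sub>m t" "Ki * K = 1\<^sub>m t"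
    using dual_mat_inverse[OF Kp J] JKJ unfolding dual_mat_of_parts Ki_def[symmetric]
    by (simp_all add: Ki_def minus_carrier_mat)
  note core_parts = core_block_parts[where \<mu> = \<mu>, OF J(1) Kp(2) app, folded S_def Ki_def]
  define Si where "Si = mat_inv S"
  have Si: "Si \<in> carrier_mat t t" "S * Si = 1\<^sub>m t" "Si * S = 1\<^sub>m t"
    unfolding Si_def core_parts(3) using mat_diag_dual_inverse[OF app] by (simp_all add: S_def)
  have DW: "D * W = four_block_mat (S * K) (S * L) (0\<^sub>m k t) (0\<^sub>m k k)"
    unfolding D_def W_eq using Sc blocks mult_carrier_mat[OF Sc blocks(1)] mult_carrier_mat[OF Sc blocks(2)]
    by (simp add: mult_four_block_mat[of _ t t _ k _ k _ _ t _ k]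
        left_mult_zero_mat[of _ t] left_mult_zero_mat[of _ k])
  have "A = P * (D * W) * adj P"
  proof -
    have "P * adj P = 1\<^sub>m n" using P by (simp add: unitary_def)
    then show ?thesis using Pc Vc Dc unfolding A_eq W_def by (simp add: sq right_mult_one_mat[of _ n n])
  qed
  then have A_eq': "A = P * four_block_mat (S * K) (S * L) (0\<^sub>m k t) (0\<^sub>m k k) * adj P"
    unfolding DW .
  define X where "X = P * four_block_mat (Ki * Si) (0\<^sub>m t k) (0\<^sub>m k t) (0\<^sub>m k k) * adj P"
  have core: "A * (X * A) = A" "dc_core A = X"
    using block_core[OF P[unfolded n] Sc Si blocks(1) Ki blocks(2)] unfolding A_eq' X_def by blast+
  have X: "X \<in> carrier_mat n n"
    using Pc four_block_carrier_mat[OF mult_carrier_mat[OF Ki(1) Si(1)] zero_carrier_mat[of k k]]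
    unfolding X_def n by (auto intro!: mult_carrier_mat)
  have "A * X * A = A" using core(1) A X by (simp add: sq)
  \<comment> \<open>Only here are the block sizes \<open>t\<close> known to be the rank.\<close>
  from dual_rank_eqI[OF svd A X this] have r: "r = t" using assms(2) by simp
  have "invertible_mat (std_mat K)"
    using J Kp(1) by (auto simp: invertible_mat_def inverts_mat_def)
  moreover have "dc_core A = P * (four_block_mat
                (of_std_mat J * mat_inv S)
                (0\<^sub>m t k) (0\<^sub>m k t) (0\<^sub>m k k)
              - eps \<cdot>\<^sub>m four_block_mat
                (of_std_mat (J * inf_mat K * J) * mat_inv S)
                (0\<^sub>m t k) (0\<^sub>m k t) (0\<^sub>m k k)) * adj P"
    using four_block_top_left_diff[OF mult_carrier_mat[OF _ Si(1)] mult_carrier_mat[OF _ Si(1)]] J(1) JKJ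
    unfolding core(2) X_def Si_def core_parts(1) by simp
  moreover have G: "J * inf_mat K * J * mat_inv (std_mat S)
      + J * (mat_inv (std_mat S) ^\<^sub>m 2) * inf_mat S \<in> carrier_mat t t"
    by (rule add_carrier_mat, rule mult_carrier_mat[OF mult_carrier_mat[OF J(1) pow_carrier_mat[OF core_parts(4)]]])
      (use Sc in simp)
  moreover have "dc_core A = P * (of_std_mat (four_block_mat
                (J * mat_inv (std_mat S))
                (0\<^sub>m t k) (0\<^sub>m k t) (0\<^sub>m k k))
              - eps \<cdot>\<^sub>m of_std_mat (four_block_mat
                (J * inf_mat K * J * mat_inv (std_mat S)
                  + J * (mat_inv (std_mat S) ^\<^sub>m 2) * inf_mat S)
                (0\<^sub>m t k) (0\<^sub>m k t) (0\<^sub>m k k))) * adj P"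
    using mult_carrier_mat[OF J(1) core_parts(4)] G
    unfolding core(2) X_def Si_def core_parts(2)
    by (simp add: of_std_mat_four_block_top_left four_block_top_left_diff)
  ultimately show ?thesis
    using P blocks Kp pos app mono A_eq' unitary_top_row_blocks[OF W[unfolded W_eq n] blocks]
    unfolding r
    by (intro exI[of _ P] exI[of _ "std_mat K"] exI[of _ "inf_mat K"] exI[of _ "std_mat L"]
        exI[of _ "inf_mat L"] exI[of _ \<mu>])
      (simp add: Let_def DC_U_iff_unitary dual_mat_of_parts Jinv flip: S_def k_def)
qed

end
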